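(* Let $(\mathbb{R}\times S,g)$ be a globally hyperbolic standard stationary spacetime, with $g=-(\beta\circ\pi)\,dt^2+\pi^*\omega\otimes dt+dt\otimes\pi^*\omega+\pi^*g_0$. Then the Riemannian metric on $S$ $$h=\frac{1}{\beta}g_0+\frac{1}{\beta^2}\omega\otimes\omega$$ is complete.
   Context: Standard stationary spacetime: $S$ is a smooth connected (paracompact) manifold, $\pi:\mathbb{R}\times S\to S$ and $t:\mathbb{R}\times S\to\mathbb{R}$ are the projections, $g_0$ is a Riemannian metric on $S$, $\omega$ a smooth $1$-form on $S$ and $\beta$ a smooth positive function on $S$; $g$ is the Lorentzian metric displayed in the statement, time-oriented so that $\partial_t$ is future-pointing. A spacetime is globally hyperbolic if it admits a Cauchy hypersurface, i.e. a subset met exactly once by every inextensible timelike curve. *)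

theory Defs
  imports "HOL-Analysis.Analysis"
begin

section \<open>Smooth maps between open subsets of Euclidean spaces\<close>

text \<open>Only meant for an open set \<open>S\<close>: the derivatives are two-sided ones in the ambient space.\<close>

fun Ck_on :: "nat \<Rightarrow> 'a::euclidean_space set \<Rightarrow> ('a \<Rightarrow> 'b::real_normed_vector) \<Rightarrow> bool" where
  "Ck_on 0 S f \<longleftrightarrow> continuous_on S f"
| "Ck_on (Suc k) S f \<longleftrightarrow> (\<forall>x\<in>S. f differentiable (at x)) \<and>
     (\<forall>v. Ck_on k S (\<lambda>x. frechet_derivative f (at x) v))"

definition smooth_on :: "'a::euclidean_space set \<Rightarrow> ('a \<Rightarrow> 'b::real_normed_vector) \<Rightarrow> bool" where
  "smooth_on S f \<longleftrightarrow> (\<forall>k. Ck_on k S f)"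

section \<open>Manifolds\<close>

text \<open>
  A chart is a pair of its domain and its coordinate map; the values of the coordinate map
  outside the domain are irrelevant. The underlying topological space of a manifold is a whole
  type, and its smooth structure is given by an arbitrary (not necessarily maximal) atlas.
\<close>

type_synonym ('m, 'e) chart = "'m set \<times> ('m \<Rightarrow> 'e)"

abbreviation chart_dom :: "('m, 'e) chart \<Rightarrow> 'm set" where "chart_dom c \<equiv> fst c"
abbreviation chart_map :: "('m, 'e) chart \<Rightarrow> 'm \<Rightarrow> 'e" where "chart_map c \<equiv> snd c"
abbreviation chart_img :: "('m, 'e) chart \<Rightarrow> 'e set" where "chart_img c \<equiv> chart_map c ` chart_dom c"

definition chart_inv :: "('m, 'e) chart \<Rightarrow> 'e \<Rightarrow> 'm" where
  "chart_inv c = inv_into (chart_dom c) (chart_map c)"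

definition is_chart :: "('m::topological_space, 'e::euclidean_space) chart \<Rightarrow> bool" where
  "is_chart c \<longleftrightarrow> open (chart_dom c) \<and> open (chart_img c) \<and>
     homeomorphism (chart_dom c) (chart_img c) (chart_map c) (chart_inv c)"

definition smooth_atlas :: "('m::topological_space, 'e::euclidean_space) chart set \<Rightarrow> bool" where
  "smooth_atlas A \<longleftrightarrow> (\<forall>c\<in>A. is_chart c) \<and> (\<Union>c\<in>A. chart_dom c) = UNIV \<and>
     (\<forall>c\<in>A. \<forall>d\<in>A. smooth_on (chart_map c ` (chart_dom c \<inter> chart_dom d)) (chart_map d \<circ> chart_inv c))"

definition paracompact :: "'m::topological_space set \<Rightarrow> bool" where
  "paracompact X \<longleftrightarrow>
     (\<forall>\<U>. (\<forall>U\<in>\<U>. openin (top_of_set X) U) \<and> \<Union>\<U> = X \<longrightarrow>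
       (\<exists>\<V>. (\<forall>V\<in>\<V>. openin (top_of_set X) V) \<and> \<Union>\<V> = X \<and>
         (\<forall>V\<in>\<V>. \<exists>U\<in>\<U>. V \<subseteq> U) \<and> locally_finite_in (top_of_set X) \<V>))"

definition smooth_manifold :: "('m::t2_space, 'e::euclidean_space) chart set \<Rightarrow> bool" where
  "smooth_manifold A \<longleftrightarrow> smooth_atlas A \<and> paracompact (UNIV :: 'm set)"

definition real_atlas :: "(real, real) chart set" where
  "real_atlas = {(UNIV, id)}"

definition prod_atlas ::
    "('m, 'e) chart set \<Rightarrow> ('n, 'f) chart set \<Rightarrow> ('m \<times> 'n, 'e \<times> 'f) chart set" where
  "prod_atlas A B =
     {(chart_dom c \<times> chart_dom d, map_prod (chart_map c) (chart_map d)) | c d. c \<in> A \<and> d \<in> B}"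

definition smooth_function ::
    "('m::topological_space, 'e::euclidean_space) chart set \<Rightarrow> ('m \<Rightarrow> real) \<Rightarrow> bool" where
  "smooth_function A f \<longleftrightarrow> (\<forall>c\<in>A. smooth_on (chart_img c) (f \<circ> chart_inv c))"

section \<open>Tangent vectors and differentials\<close>

text \<open>
  A tangent vector at \<open>p\<close> is the family of its component vectors in all charts around \<open>p\<close>, subject
  to the usual transformation law under change of chart. Entries at charts that are not around \<open>p\<close>
  are set to 0, so that such a family is determined by its components in any one chart.
\<close>

type_synonym ('m, 'e) tvec = "('m, 'e) chart \<Rightarrow> 'e"

definition tangent_space ::
    "('m, 'e::euclidean_space) chart set \<Rightarrow> 'm \<Rightarrow> ('m, 'e) tvec set" where
  "tangent_space A p = {X.
     (\<forall>c. \<not> (c \<in> A \<and> p \<in> chart_dom c) \<longrightarrow> X c = 0) \<and>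
     (\<forall>c\<in>A. \<forall>d\<in>A. p \<in> chart_dom c \<longrightarrow> p \<in> chart_dom d \<longrightarrow>
        X d = frechet_derivative (chart_map d \<circ> chart_inv c) (at (chart_map c p)) (X c))}"

text \<open>The tangent vector at \<open>p\<close> with component vector \<open>v\<close> in the chart \<open>c\<close>.\<close>

definition tvec_of ::
    "('m, 'e::euclidean_space) chart set \<Rightarrow> 'm \<Rightarrow> ('m, 'e) chart \<Rightarrow> 'e \<Rightarrow> ('m, 'e) tvec" where
  "tvec_of A p c v = (\<lambda>d. if d \<in> A \<and> p \<in> chart_dom d
     then frechet_derivative (chart_map d \<circ> chart_inv c) (at (chart_map c p)) v else 0)"

text \<open>
  The differential of a vector-valued function \<open>f\<close> at \<open>p\<close>, applied to \<open>X\<close>. By the transformation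
  law the result does not depend on the chart around \<open>p\<close> used to compute it.
\<close>

definition diff_fun ::
    "('m, 'e::euclidean_space) chart set \<Rightarrow> ('m \<Rightarrow> 'b::real_normed_vector) \<Rightarrow> 'm \<Rightarrow> ('m, 'e) tvec \<Rightarrow> 'b" where
  "diff_fun A f p X =
     (let c = (SOME c. c \<in> A \<and> p \<in> chart_dom c)
      in frechet_derivative (f \<circ> chart_inv c) (at (chart_map c p)) (X c))"

definition pushforward ::
    "('m, 'e::euclidean_space) chart set \<Rightarrow> ('n, 'f::euclidean_space) chart set \<Rightarrow> ('m \<Rightarrow> 'n) \<Rightarrow>
     'm \<Rightarrow> ('m, 'e) tvec \<Rightarrow> ('n, 'f) tvec" where
  "pushforward A B f p X =
     (\<lambda>d. if d \<in> B \<and> f p \<in> chart_dom d then diff_fun A (chart_map d \<circ> f) p X else 0)"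

section \<open>Tensor fields\<close>

text \<open>Values of tensor fields at \<open>p\<close> on arguments outside the tangent space at \<open>p\<close> are irrelevant.\<close>

type_synonym ('m, 'e) form1 = "'m \<Rightarrow> ('m, 'e) tvec \<Rightarrow> real"
type_synonym ('m, 'e) tensor2 = "'m \<Rightarrow> ('m, 'e) tvec \<Rightarrow> ('m, 'e) tvec \<Rightarrow> real"

definition linear_form_at ::
    "('m, 'e::euclidean_space) chart set \<Rightarrow> 'm \<Rightarrow> (('m, 'e) tvec \<Rightarrow> real) \<Rightarrow> bool" where
  "linear_form_at A p \<alpha> \<longleftrightarrow> (\<forall>X\<in>tangent_space A p. \<forall>Y\<in>tangent_space A p. \<forall>a b.
     \<alpha> (\<lambda>c. a *\<^sub>R X c + b *\<^sub>R Y c) = a * \<alpha> X + b * \<alpha> Y)"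

definition smooth_form1 ::
    "('m::topological_space, 'e::euclidean_space) chart set \<Rightarrow> ('m, 'e) form1 \<Rightarrow> bool" where
  "smooth_form1 A \<omega> \<longleftrightarrow> (\<forall>p. linear_form_at A p (\<omega> p)) \<and>
     (\<forall>c\<in>A. \<forall>v. smooth_on (chart_img c) (\<lambda>x. \<omega> (chart_inv c x) (tvec_of A (chart_inv c x) c v)))"

definition riemannian_metric ::
    "('m::topological_space, 'e::euclidean_space) chart set \<Rightarrow> ('m, 'e) tensor2 \<Rightarrow> bool" where
  "riemannian_metric A h \<longleftrightarrow>
     (\<forall>p. \<forall>X\<in>tangent_space A p. linear_form_at A p (h p X)) \<and>
     (\<forall>p. \<forall>X\<in>tangent_space A p. \<forall>Y\<in>tangent_space A p. h p X Y = h p Y X) \<and>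
     (\<forall>p. \<forall>X\<in>tangent_space A p. X \<noteq> (\<lambda>_. 0) \<longrightarrow> h p X X > 0) \<and>
     (\<forall>c\<in>A. \<forall>v w. smooth_on (chart_img c)
        (\<lambda>x. h (chart_inv c x) (tvec_of A (chart_inv c x) c v) (tvec_of A (chart_inv c x) c w)))"

section \<open>Curves\<close>

text \<open>Meant for an open set \<open>I\<close> of parameters.\<close>

definition smooth_curve_on ::
    "('m::topological_space, 'e::euclidean_space) chart set \<Rightarrow> real set \<Rightarrow> (real \<Rightarrow> 'm) \<Rightarrow> bool" where
  "smooth_curve_on A I \<gamma> \<longleftrightarrow> continuous_on I \<gamma> \<and>
     (\<forall>c\<in>A. smooth_on (I \<inter> \<gamma> -` chart_dom c) (chart_map c \<circ> \<gamma>))"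

definition velocity ::
    "('m, 'e::euclidean_space) chart set \<Rightarrow> (real \<Rightarrow> 'm) \<Rightarrow> real \<Rightarrow> ('m, 'e) tvec" where
  "velocity A \<gamma> s =
     (\<lambda>c. if c \<in> A \<and> \<gamma> s \<in> chart_dom c then vector_derivative (chart_map c \<circ> \<gamma>) (at s) else 0)"

text \<open>
  Away from a finite set \<open>F\<close> of break points the curve is smooth; on each closed piece \<open>{u..v}\<close>
  between break points it is the restriction of a curve that is smooth on an open set
  containing \<open>{u..v}\<close>.
\<close>

definition piecewise_smooth_curve ::
    "('m::topological_space, 'e::euclidean_space) chart set \<Rightarrow> real \<Rightarrow> real \<Rightarrow> (real \<Rightarrow> 'm) \<Rightarrow> bool" where
  "piecewise_smooth_curve A a b \<gamma> \<longleftrightarrow> continuous_on {a..b} \<gamma> \<and>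
     (\<exists>F. finite F \<and>
       (\<forall>u v. a \<le> u \<and> u < v \<and> v \<le> b \<and> {u<..<v} \<inter> F = {} \<longrightarrow>
         (\<exists>J \<delta>. open J \<and> {u..v} \<subseteq> J \<and> smooth_curve_on A J \<delta> \<and> (\<forall>s\<in>{u..v}. \<delta> s = \<gamma> s))))"

section \<open>Completeness of Riemannian metrics\<close>

definition curve_length ::
    "('m, 'e::euclidean_space) chart set \<Rightarrow> ('m, 'e) tensor2 \<Rightarrow> real \<Rightarrow> real \<Rightarrow> (real \<Rightarrow> 'm) \<Rightarrow> real" where
  "curve_length A h a b \<gamma> =
     integral {a..b} (\<lambda>s. sqrt (h (\<gamma> s) (velocity A \<gamma> s) (velocity A \<gamma> s)))"

definition riemannian_dist ::
    "('m::topological_space, 'e::euclidean_space) chart set \<Rightarrow> ('m, 'e) tensor2 \<Rightarrow> 'm \<Rightarrow> 'm \<Rightarrow> real" where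
  "riemannian_dist A h x y = Inf {curve_length A h a b \<gamma> | a b \<gamma>.
     a < b \<and> piecewise_smooth_curve A a b \<gamma> \<and> \<gamma> a = x \<and> \<gamma> b = y}"

text \<open>Completeness of the associated metric space.\<close>

definition riemannian_complete ::
    "('m::topological_space, 'e::euclidean_space) chart set \<Rightarrow> ('m, 'e) tensor2 \<Rightarrow> bool" where
  "riemannian_complete A h \<longleftrightarrow>
     (\<forall>x :: nat \<Rightarrow> 'm.
        (\<forall>\<epsilon>>0. \<exists>N. \<forall>m\<ge>N. \<forall>n\<ge>N. riemannian_dist A h (x m) (x n) < \<epsilon>) \<longrightarrow>
        (\<exists>l. (\<lambda>n. riemannian_dist A h (x n) l) \<longlonglongrightarrow> 0))"

section \<open>Global hyperbolicity\<close>

text \<open>Curves of both time orientations are included.\<close>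

definition timelike_curve ::
    "('m::topological_space, 'e::euclidean_space) chart set \<Rightarrow> ('m, 'e) tensor2 \<Rightarrow>
     real set \<Rightarrow> (real \<Rightarrow> 'm) \<Rightarrow> bool" where
  "timelike_curve A g I \<gamma> \<longleftrightarrow> open I \<and> is_interval I \<and> I \<noteq> {} \<and> smooth_curve_on A I \<gamma> \<and>
     (\<forall>s\<in>I. g (\<gamma> s) (velocity A \<gamma> s) (velocity A \<gamma> s) < 0)"

text \<open>
  Endpoints are limit points of the curve at the (possibly infinite) ends of its open parameter
  interval. A curve is inextensible if it has no endpoint in either direction; this notion is
  invariant under reparametrization.
\<close>

definition upper_endpoint :: "real set \<Rightarrow> (real \<Rightarrow> 'm::topological_space) \<Rightarrow> 'm \<Rightarrow> bool" where
  "upper_endpoint I \<gamma> p \<longleftrightarrow>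
     (\<forall>U. open U \<and> p \<in> U \<longrightarrow> (\<exists>s\<^sub>0\<in>I. \<forall>s\<in>I. s\<^sub>0 \<le> s \<longrightarrow> \<gamma> s \<in> U))"

definition lower_endpoint :: "real set \<Rightarrow> (real \<Rightarrow> 'm::topological_space) \<Rightarrow> 'm \<Rightarrow> bool" where
  "lower_endpoint I \<gamma> p \<longleftrightarrow>
     (\<forall>U. open U \<and> p \<in> U \<longrightarrow> (\<exists>s\<^sub>0\<in>I. \<forall>s\<in>I. s \<le> s\<^sub>0 \<longrightarrow> \<gamma> s \<in> U))"

definition inextensible :: "real set \<Rightarrow> (real \<Rightarrow> 'm::topological_space) \<Rightarrow> bool" where
  "inextensible I \<gamma> \<longleftrightarrow> (\<nexists>p. upper_endpoint I \<gamma> p) \<and> (\<nexists>p. lower_endpoint I \<gamma> p)"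

definition cauchy_hypersurface ::
    "('m::topological_space, 'e::euclidean_space) chart set \<Rightarrow> ('m, 'e) tensor2 \<Rightarrow> 'm set \<Rightarrow> bool" where
  "cauchy_hypersurface A g \<Sigma> \<longleftrightarrow>
     (\<forall>I \<gamma>. timelike_curve A g I \<gamma> \<and> inextensible I \<gamma> \<longrightarrow> (\<exists>!s. s \<in> I \<and> \<gamma> s \<in> \<Sigma>))"

definition globally_hyperbolic ::
    "('m::topological_space, 'e::euclidean_space) chart set \<Rightarrow> ('m, 'e) tensor2 \<Rightarrow> bool" where
  "globally_hyperbolic A g \<longleftrightarrow> (\<exists>\<Sigma>. cauchy_hypersurface A g \<Sigma>)"

section \<open>Standard stationary spacetimes\<close>

definition pullback1 ::
    "('m, 'e::euclidean_space) chart set \<Rightarrow> ('n, 'f::euclidean_space) chart set \<Rightarrow> ('m \<Rightarrow> 'n) \<Rightarrow>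
     ('n, 'f) form1 \<Rightarrow> ('m, 'e) form1" where
  "pullback1 A B f \<omega> = (\<lambda>p X. \<omega> (f p) (pushforward A B f p X))"

definition pullback2 ::
    "('m, 'e::euclidean_space) chart set \<Rightarrow> ('n, 'f::euclidean_space) chart set \<Rightarrow> ('m \<Rightarrow> 'n) \<Rightarrow>
     ('n, 'f) tensor2 \<Rightarrow> ('m, 'e) tensor2" where
  "pullback2 A B f T = (\<lambda>p X Y. T (f p) (pushforward A B f p X) (pushforward A B f p Y))"

definition tensor_prod :: "('m, 'e) form1 \<Rightarrow> ('m, 'e) form1 \<Rightarrow> ('m, 'e) tensor2" where
  "tensor_prod \<alpha> \<omega> = (\<lambda>p X Y. \<alpha> p X * \<omega> p Y)"

abbreviation spacetime_atlas ::
    "('s, 'e::euclidean_space) chart set \<Rightarrow> (real \<times> 's, real \<times> 'e) chart set" where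
  "spacetime_atlas A \<equiv> prod_atlas real_atlas A"

text \<open>Here \<open>fst\<close> is the time function \<open>t\<close> and \<open>snd\<close> is the projection \<open>\<pi>\<close>.\<close>

definition stationary_metric ::
    "('s, 'e::euclidean_space) chart set \<Rightarrow> ('s \<Rightarrow> real) \<Rightarrow> ('s, 'e) form1 \<Rightarrow> ('s, 'e) tensor2 \<Rightarrow>
     (real \<times> 's, real \<times> 'e) tensor2" where
  "stationary_metric A \<beta> \<omega> g\<^sub>0 =
     (let M = spacetime_atlas A; dt = diff_fun M fst; \<pi>\<omega> = pullback1 M A snd \<omega> in
      (\<lambda>p X Y. - (\<beta> \<circ> snd) p * tensor_prod dt dt p X Y
         + tensor_prod \<pi>\<omega> dt p X Y + tensor_prod dt \<pi>\<omega> p X Y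
         + pullback2 M A snd g\<^sub>0 p X Y))"

end

theory Submission
  imports Defs
begin

text \<open>
  Suppose that \<open>h\<close> is not complete. A Cauchy sequence without limit yields a smooth curve \<open>c\<close> of finite
  \<open>h\<close>-length on a half line that has no endpoint. Let \<open>T\<close> be a primitive of a positive smooth function
  dominating the \<open>h\<close>-speed of \<open>c\<close>, with \<open>T\<close> bounded above and unbounded below. Since \<open>h\<close> is the square of
  the symmetric part of the Fermat metric \<open>sqrt (h(v, v)) + \<omega>(v) / \<beta>\<close>, whose other part is smaller in
  absolute value, the curves \<open>s \<mapsto> (k T(s) + a, c(s))\<close> with \<open>\<bar>k\<bar> \<ge> 2\<close> are timelike; they are inextensible
  although their time component stays bounded towards the future for \<open>k > 0\<close>. Each of them and each
  integral curve of \<open>\<partial>\<^sub>t\<close> meets a Cauchy hypersurface exactly once, which is contradictory.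
\<close>

section \<open>Calculus of smooth maps\<close>

text \<open>On a velocity with time part r and space part v the spacetime metric equals \<beta>
  times h(v, v) - (r - \<omega>(v)/\<beta>)^2, so timelike means that |r - \<omega>(v)/\<beta>|
  exceeds sqrt (h(v, v)). As |\<omega>(v)/\<beta>| is at most sqrt (h(v, v)), a rate of at least
  twice a strict bound of the h-speed suffices in either time direction; this is the origin of the
  slope bound 2. All that is known of a Cauchy hypersurface is how often smooth inextensible
  timelike curves meet it. The test curves therefore lie over a single base curve and differ by an
  affine change of time only, so that two points of the hypersurface over that curve are again
  joined by a test curve. Smoothness is the main obstacle: the distance is an infimum over curves
  with corners. Every smooth piece is reparametrized so as to rest at its ends, which preserves its
  length and makes concatenations smooth. The base curve also rests towards minus infinity, where it
  does have an endpoint; inextensibility there must come from the time component, which is why T has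
  to be unbounded below.\<close>

lemma has_derivative_cong_open:
  assumes "open S" "x \<in> S" "\<And>y. y \<in> S \<Longrightarrow> f y = g y"
  shows "(f has_derivative f') (at x) \<longleftrightarrow> (g has_derivative f') (at x)"
  using has_derivative_transform_within_open[of f f' x UNIV S g]
        has_derivative_transform_within_open[of g f' x UNIV S f] assms by auto

lemma frechet_derivative_cong_open:
  assumes "open S" "x \<in> S" "\<And>y. y \<in> S \<Longrightarrow> f y = g y"
  shows "frechet_derivative f (at x) = frechet_derivative g (at x)"
    and "f differentiable (at x) \<longleftrightarrow> g differentiable (at x)"
  using has_derivative_cong_open[OF assms] by (auto simp: frechet_derivative_def differentiable_def)

lemma Ck_on_cong:
  assumes "open S" "\<And>x. x \<in> S \<Longrightarrow> f x = g x"
  shows "Ck_on k S f \<longleftrightarrow> Ck_on k S g"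
  using assms(2)
proof (induction k arbitrary: f g)
  case 0
  then show ?case by (auto cong: continuous_on_cong)
next
  case (Suc k)
  have "Ck_on k S (\<lambda>x. frechet_derivative f (at x) v) \<longleftrightarrow> Ck_on k S (\<lambda>x. frechet_derivative g (at x) v)" for v
    by (rule Suc.IH) (simp add: frechet_derivative_cong_open(1)[OF assms(1) _ Suc.prems])
  then show ?case
    using frechet_derivative_cong_open(2)[OF assms(1) _ Suc.prems] by simp
qed

lemma Ck_on_subset: "Ck_on k S f \<Longrightarrow> T \<subseteq> S \<Longrightarrow> Ck_on k T f"
  by (induction k arbitrary: f) (auto intro: continuous_on_subset)

lemma Ck_on_local:
  assumes "\<And>x. x \<in> S \<Longrightarrow> \<exists>U. open U \<and> x \<in> U \<and> Ck_on k U f"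
  shows "Ck_on k S f"
  using assms
proof (induction k arbitrary: f)
  case 0
  then have "\<forall>x\<in>S. isCont f x"
    by (metis Ck_on.simps(1) continuous_on_eq_continuous_at)
  then show ?case by (simp add: continuous_at_imp_continuous_on)
next
  case (Suc k)
  have "Ck_on k S (\<lambda>x. frechet_derivative f (at x) v)" for v
  proof (rule Suc.IH)
    fix x assume "x \<in> S"
    then show "\<exists>U. open U \<and> x \<in> U \<and> Ck_on k U (\<lambda>x. frechet_derivative f (at x) v)"
      using Suc.prems[of x] by auto
  qed
  moreover have "\<forall>x\<in>S. f differentiable (at x)"
    using Suc.prems by fastforce
  ultimately show ?case by simp
qed

lemma Ck_on_continuous: "Ck_on k S f \<Longrightarrow> continuous_on S f"
  by (cases k)
     (auto intro!: continuous_at_imp_continuous_on differentiable_imp_continuous_within)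

lemma Ck_on_SucD: "Ck_on (Suc k) S f \<Longrightarrow> Ck_on k S f"
proof (induction k arbitrary: f)
  case 0
  then show ?case using Ck_on_continuous[of "Suc 0"] by simp
next
  case (Suc k)
  show ?case
    using Suc.prems Suc.IH unfolding Ck_on.simps(2)[of "Suc k"] Ck_on.simps(2)[of k] by blast
qed

text \<open>Replaces the opaque \<open>frechet_derivative\<close> by an explicit formula, to which
  the induction hypotheses of the closure lemmas below apply.\<close>

lemma Ck_on_SucI:
  assumes "open S" "\<And>x. x \<in> S \<Longrightarrow> (f has_derivative f' x) (at x)"
    and "\<And>v. Ck_on k S (\<lambda>x. f' x v)"
  shows "Ck_on (Suc k) S f"
proof -
  have eq: "f' x v = frechet_derivative f (at x) v" if "x \<in> S" for x v
    using frechet_derivative_at[OF assms(2)[OF that]] by simp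
  have "Ck_on k S (\<lambda>x. frechet_derivative f (at x) v)" for v
    using Ck_on_cong[OF assms(1), of "\<lambda>x. f' x v" "\<lambda>x. frechet_derivative f (at x) v" k] eq assms(3) by blast
  then show ?thesis
    using assms(2) by (auto simp: differentiable_def)
qed

lemma Ck_on_SucE:
  assumes "Ck_on (Suc k) S f"
  shows "x \<in> S \<Longrightarrow> (f has_derivative frechet_derivative f (at x)) (at x)"
    and "Ck_on k S (\<lambda>x. frechet_derivative f (at x) v)"
  using assms by (auto simp: frechet_derivative_works)

lemma Ck_on_const: "open S \<Longrightarrow> Ck_on k S (\<lambda>x. c)"
proof (induction k arbitrary: c)
  case (Suc k)
  show ?case by (rule Ck_on_SucI[OF Suc.prems, where f' = "\<lambda>x v. 0"]) (auto intro: Suc)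
qed auto

lemma Ck_on_ident: "open S \<Longrightarrow> Ck_on k S (\<lambda>x. x)"
  by (cases k) (auto intro!: Ck_on_SucI[where f' = "\<lambda>x v. v"] Ck_on_const simp del: Ck_on.simps(2))

lemma Ck_on_linear:
  assumes "bounded_linear L" "open S"
  shows "Ck_on k S f \<Longrightarrow> Ck_on k S (\<lambda>x. L (f x))"
proof (induction k arbitrary: f)
  case 0
  then show ?case using bounded_linear.continuous_on[OF assms(1)] by simp
next
  case (Suc k)
  show ?case
  proof (rule Ck_on_SucI[OF assms(2)])
    show "((\<lambda>x. L (f x)) has_derivative (\<lambda>v. L (frechet_derivative f (at x) v))) (at x)"
      if "x \<in> S" for x
      by (rule bounded_linear.has_derivative[OF assms(1) Ck_on_SucE(1)[OF Suc.prems that]])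
    show "Ck_on k S (\<lambda>x. L (frechet_derivative f (at x) v))" for v
      by (rule Suc.IH[OF Ck_on_SucE(2)[OF Suc.prems]])
  qed
qed

lemma Ck_on_add:
  assumes "open S"
  shows "Ck_on k S f \<Longrightarrow> Ck_on k S g \<Longrightarrow> Ck_on k S (\<lambda>x. f x + g x)"
proof (induction k arbitrary: f g)
  case 0
  then show ?case by (simp add: continuous_on_add)
next
  case (Suc k)
  show ?case
    by (rule Ck_on_SucI[OF assms, where f' = "\<lambda>x v. frechet_derivative f (at x) v + frechet_derivative g (at x) v"])
       (use Ck_on_SucE[OF Suc.prems(1)] Ck_on_SucE[OF Suc.prems(2)] Suc.IH in \<open>auto intro: has_derivative_add\<close>)
qed

lemma Ck_on_sum:
  assumes "open S"
  shows "(\<And>i. i \<in> I \<Longrightarrow> Ck_on k S (f i)) \<Longrightarrow> Ck_on k S (\<lambda>x. \<Sum>i\<in>I. f i x)"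
  by (induction I rule: infinite_finite_induct) (auto intro: Ck_on_const Ck_on_add assms)

lemma Ck_on_bilinear:
  assumes "bounded_bilinear p" "open S"
  shows "Ck_on k S f \<Longrightarrow> Ck_on k S g \<Longrightarrow> Ck_on k S (\<lambda>x. p (f x) (g x))"
proof (induction k arbitrary: f g)
  case 0
  then show ?case using bounded_bilinear.continuous_on[OF assms(1)] by simp
next
  case (Suc k)
  show ?case
    by (rule Ck_on_SucI[OF assms(2), where
          f' = "\<lambda>x v. p (f x) (frechet_derivative g (at x) v) + p (frechet_derivative f (at x) v) (g x)"])
       (use Ck_on_SucE[OF Suc.prems(1)] Ck_on_SucE[OF Suc.prems(2)]
            Ck_on_SucD[OF Suc.prems(1)] Ck_on_SucD[OF Suc.prems(2)] Suc.IH
            in \<open>auto intro!: Ck_on_add[OF assms(2)] bounded_bilinear.FDERIV[OF assms(1)]\<close>)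
qed

text \<open>In the chain rule the direction fed to the derivative of \<open>g\<close> varies with
  the point. Expanding it in the basis leaves derivatives of \<open>g\<close> in constant
  directions, composed with the same \<open>f\<close>, and those are covered by the induction
  hypothesis.\<close>

lemma Ck_on_compose:
  fixes f :: "'a::euclidean_space \<Rightarrow> 'b::euclidean_space" and g :: "'b \<Rightarrow> 'c::real_normed_vector"
  assumes "open S" "f ` S \<subseteq> T"
  shows "Ck_on k S f \<Longrightarrow> Ck_on k T g \<Longrightarrow> Ck_on k S (\<lambda>x. g (f x))"
proof (induction k arbitrary: g)
  case 0
  then show ?case using assms(2) by (auto intro: continuous_on_compose2)
next
  case (Suc k)
  let ?f' = "\<lambda>x v. \<Sum>b\<in>Basis. (frechet_derivative f (at x) v \<bullet> b) *\<^sub>R frechet_derivative g (at (f x)) b"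
  show ?case
  proof (rule Ck_on_SucI[OF assms(1), where f' = ?f'])
    fix x assume x: "x \<in> S"
    have fx: "(f has_derivative frechet_derivative f (at x)) (at x)"
      and gx: "(g has_derivative frechet_derivative g (at (f x))) (at (f x))"
      using Ck_on_SucE(1)[OF Suc.prems(1) x] Ck_on_SucE(1)[OF Suc.prems(2)] assms(2) x by auto
    have lin: "linear (frechet_derivative g (at (f x)))"
      using gx has_derivative_linear by blast
    have "(\<Sum>b\<in>Basis. (w \<bullet> b) *\<^sub>R frechet_derivative g (at (f x)) b) = frechet_derivative g (at (f x)) w" for w
      by (subst (2) euclidean_representation[symmetric, of w])
         (simp only: linear_sum[OF lin] linear_scale[OF lin])
    then show "((\<lambda>x. g (f x)) has_derivative ?f' x) (at x)"
      using has_derivative_compose[OF fx gx] by simp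
  next
    fix v
    show "Ck_on k S (\<lambda>x. ?f' x v)"
      using Ck_on_SucE(2)[OF Suc.prems(1)] Ck_on_SucE(2)[OF Suc.prems(2)] Ck_on_SucD[OF Suc.prems(1)]
      by (intro Ck_on_sum[OF assms(1)] Ck_on_bilinear[OF bounded_bilinear_scaleR assms(1)]
           Ck_on_linear[OF bounded_linear_inner_left assms(1)] Suc.IH) auto
  qed
qed

text \<open>The induction closes because the derivative is a polynomial in the function
  itself.\<close>

lemma Ck_on_inverse: "Ck_on k (- {0}) (inverse :: real \<Rightarrow> real)"
proof (induction k)
  case 0
  show ?case using continuous_on_inverse[OF continuous_on_id, of "- {0}"] by auto
next
  case (Suc k)
  have op: "open (- {0::real})" by (intro open_Compl closed_singleton)
  show ?case
  proof (rule Ck_on_SucI[OF op])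
    show "(inverse has_derivative (\<lambda>v. - (inverse x * v * inverse x))) (at x)" if "x \<in> - {0}" for x :: real
      using has_derivative_inverse' that by simp
    show "Ck_on k (- {0}) (\<lambda>x. - (inverse x * v * inverse x))" for v :: real
      by (rule Ck_on_linear[OF bounded_linear_minus[OF bounded_linear_ident] op]
            Ck_on_bilinear[OF bounded_bilinear_mult op] Ck_on_const[OF op] Suc)+
  qed
qed

lemma Ck_on_sqrt: "Ck_on k {0<..} sqrt"
proof (induction k)
  case 0
  show ?case using continuous_on_real_sqrt[OF continuous_on_id, of "{0<..}"] by simp
next
  case (Suc k)
  show ?case
  proof (rule Ck_on_SucI[where f' = "\<lambda>x v. inverse (sqrt x) * (v / 2)"])
    fix x :: real assume "x \<in> {0<..}"
    then show "(sqrt has_derivative (\<lambda>v. inverse (sqrt x) * (v / 2))) (at x)"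
      by (auto intro!: derivative_eq_intros simp: field_simps)
  next
    fix v :: real
    show "Ck_on k {0<..} (\<lambda>x. inverse (sqrt x) * (v / 2))"
      by (intro Ck_on_bilinear[OF bounded_bilinear_mult] Ck_on_const
            Ck_on_compose[OF _ _ _ Ck_on_inverse] Suc) auto
  qed simp
qed

section \<open>Closure properties of smooth functions\<close>

lemma smooth_on_cong:
  "open S \<Longrightarrow> (\<And>x. x \<in> S \<Longrightarrow> f x = g x) \<Longrightarrow> smooth_on S f \<longleftrightarrow> smooth_on S g"
  unfolding smooth_on_def using Ck_on_cong[of S f g] by simp

lemma smooth_on_subset: "smooth_on S f \<Longrightarrow> T \<subseteq> S \<Longrightarrow> smooth_on T f"
  unfolding smooth_on_def using Ck_on_subset by blast

lemma smooth_on_local: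
  assumes "\<And>x. x \<in> S \<Longrightarrow> \<exists>U. open U \<and> x \<in> U \<and> smooth_on U f"
  shows "smooth_on S f"
  unfolding smooth_on_def
proof (intro allI Ck_on_local)
  fix k x assume "x \<in> S"
  then show "\<exists>U. open U \<and> x \<in> U \<and> Ck_on k U f"
    using assms[of x] unfolding smooth_on_def by blast
qed

lemma smooth_on_continuous: "smooth_on S f \<Longrightarrow> continuous_on S f"
  unfolding smooth_on_def using Ck_on_continuous by blast

lemma smooth_on_differentiable: "smooth_on S f \<Longrightarrow> x \<in> S \<Longrightarrow> f differentiable (at x)"
  unfolding smooth_on_def using Ck_on.simps(2)[of 0 S f] by blast

lemma smooth_on_const: "open S \<Longrightarrow> smooth_on S (\<lambda>x. c)"
  by (simp add: smooth_on_def Ck_on_const)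

lemma smooth_on_ident: "open S \<Longrightarrow> smooth_on S (\<lambda>x. x)"
  by (simp add: smooth_on_def Ck_on_ident)

lemma smooth_on_linear: "bounded_linear L \<Longrightarrow> open S \<Longrightarrow> smooth_on S f \<Longrightarrow> smooth_on S (\<lambda>x. L (f x))"
  by (simp add: smooth_on_def Ck_on_linear)

lemma smooth_on_add:
  "open S \<Longrightarrow> smooth_on S f \<Longrightarrow> smooth_on S g \<Longrightarrow> smooth_on S (\<lambda>x. f x + g x)"
  by (simp add: smooth_on_def Ck_on_add)

lemma smooth_on_sum:
  "open S \<Longrightarrow> (\<And>i. i \<in> I \<Longrightarrow> smooth_on S (f i)) \<Longrightarrow> smooth_on S (\<lambda>x. \<Sum>i\<in>I. f i x)"
  by (simp add: smooth_on_def Ck_on_sum)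

lemma smooth_on_scaleR:
  "open S \<Longrightarrow> smooth_on S f \<Longrightarrow> smooth_on S g \<Longrightarrow> smooth_on S (\<lambda>x. f x *\<^sub>R g x)"
  by (simp add: smooth_on_def Ck_on_bilinear[OF bounded_bilinear_scaleR])

lemma smooth_on_mult:
  fixes f g :: "'a::euclidean_space \<Rightarrow> real"
  shows "open S \<Longrightarrow> smooth_on S f \<Longrightarrow> smooth_on S g \<Longrightarrow> smooth_on S (\<lambda>x. f x * g x)"
  by (simp add: smooth_on_def Ck_on_bilinear[OF bounded_bilinear_mult])

lemma smooth_on_Pair:
  assumes "open S" "smooth_on S f" "smooth_on S g"
  shows "smooth_on S (\<lambda>x. (f x, g x))"
proof -
  have "bounded_linear (\<lambda>y. (y, 0))" "bounded_linear (\<lambda>y. (0, y))"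
    by (intro bounded_linear_Pair bounded_linear_ident bounded_linear_zero)+
  from smooth_on_add[OF assms(1) this[THEN smooth_on_linear, OF assms(1)], OF assms(2,3)]
  show ?thesis by simp
qed

lemma smooth_on_compose:
  fixes f :: "'a::euclidean_space \<Rightarrow> 'b::euclidean_space"
  assumes "open S" "f ` S \<subseteq> T" "smooth_on S f" "smooth_on T g"
  shows "smooth_on S (\<lambda>x. g (f x))"
  using assms(3,4) Ck_on_compose[OF assms(1,2), of _ g] unfolding smooth_on_def by blast

lemma smooth_on_inverse:
  fixes f :: "'a::euclidean_space \<Rightarrow> real"
  assumes "open S" "smooth_on S f" "\<And>x. x \<in> S \<Longrightarrow> f x \<noteq> 0"
  shows "smooth_on S (\<lambda>x. inverse (f x))"
  by (rule smooth_on_compose[OF assms(1) _ assms(2), of "- {0}"])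
     (use assms(3) Ck_on_inverse in \<open>auto simp: smooth_on_def simp del: Ck_on.simps\<close>)

lemma smooth_on_sqrt:
  assumes "open S" "smooth_on S f" "\<And>x. x \<in> S \<Longrightarrow> f x > 0"
  shows "smooth_on S (\<lambda>x. sqrt (f x))"
  by (rule smooth_on_compose[OF assms(1) _ assms(2), of "{0<..}"])
     (use assms(3) Ck_on_sqrt in \<open>auto simp: smooth_on_def simp del: Ck_on.simps\<close>)

lemma smooth_affine: "smooth_on UNIV (\<lambda>s::real. k * s + m :: real)"
  by (rule smooth_on_add[OF open_UNIV smooth_on_mult[OF open_UNIV smooth_on_const[OF open_UNIV]
        smooth_on_ident[OF open_UNIV]] smooth_on_const[OF open_UNIV]])

lemma smooth_on_vector_derivative:
  fixes f :: "real \<Rightarrow> 'b::real_normed_vector"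
  assumes "open S" "smooth_on S f"
  shows "smooth_on S (\<lambda>x. vector_derivative f (at x))"
proof -
  have "vector_derivative f (at x) = frechet_derivative f (at x) 1" if "x \<in> S" for x
    using smooth_on_differentiable[OF assms(2) that] frechet_derivative_works[of f "at x"]
      has_derivative_linear[of f "frechet_derivative f (at x)" "at x"]
    by (intro vector_derivative_at) (simp add: has_vector_derivative_def linear_scale[symmetric])
  moreover have "smooth_on S (\<lambda>x. frechet_derivative f (at x) 1)"
    using assms(2) Ck_on_SucE(2) unfolding smooth_on_def by blast
  ultimately show ?thesis
    using smooth_on_cong[OF assms(1), of "\<lambda>x. vector_derivative f (at x)"] by simp
qed

lemma smooth_on_antiderivative:
  fixes f :: "real \<Rightarrow> real"
  assumes "open S" "smooth_on S f'" "\<And>x. x \<in> S \<Longrightarrow> (f has_real_derivative f' x) (at x)"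
  shows "smooth_on S f"
  unfolding smooth_on_def
proof
  fix k
  have "Ck_on (Suc k) S f"
  proof (rule Ck_on_SucI[OF assms(1), where f' = "\<lambda>x v. f' x * v"])
    show "Ck_on k S (\<lambda>x. f' x * v)" for v
      using assms(2) unfolding smooth_on_def
      by (intro Ck_on_bilinear[OF bounded_bilinear_mult] Ck_on_const assms(1)) auto
  qed (use assms(3) in \<open>auto simp: has_field_derivative_def\<close>)
  then show "Ck_on k S f" by (rule Ck_on_SucD)
qed

lemma continuous_has_antiderivative:
  fixes f :: "real \<Rightarrow> real"
  assumes "continuous_on UNIV f"
  obtains F where "\<And>x. (F has_real_derivative f x) (at x)"
proof -
  have "\<exists>F. \<forall>x. - \<infinity> < ereal x \<longrightarrow> ereal x < \<infinity> \<longrightarrow> (F has_vector_derivative f x) (at x)"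
    using assms by (intro einterval_antiderivative) (auto simp: continuous_on_eq_continuous_at)
  then show ?thesis using that by (auto simp: has_real_derivative_iff_has_vector_derivative)
qed

section \<open>A smooth step function\<close>

lemma smooth_on_exp_minus: "smooth_on UNIV (\<lambda>s::real. exp (- s))"
proof -
  have "Ck_on k UNIV (\<lambda>s::real. exp (- s))" for k
  proof (induction k)
    case (Suc k)
    show ?case
    proof (rule Ck_on_SucI[OF open_UNIV])
      show "((\<lambda>s. exp (- s)) has_derivative (\<lambda>v. exp (- s) * (- v))) (at s)" for s :: real
        by (auto intro!: derivative_eq_intros)
      show "Ck_on k UNIV (\<lambda>s::real. exp (- s) * (- v))" for v
        by (rule Ck_on_bilinear[OF bounded_bilinear_mult open_UNIV Suc Ck_on_const[OF open_UNIV]])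
    qed
  qed (auto intro!: continuous_on_exp continuous_on_minus continuous_on_id)
  then show ?thesis by (simp add: smooth_on_def)
qed

text \<open>For \<open>p = 1\<close> this is the usual flat function \<open>exp (-1/x)\<close>; the family is closed under
  differentiation.\<close>

definition flat_fun :: "real poly \<Rightarrow> real \<Rightarrow> real" where
  "flat_fun p x = (if x > 0 then poly p (1 / x) * exp (- 1 / x) else 0)"

text \<open>This is the limit of the difference quotient at 0. From the right, y = 1/x turns it into
  y p(y) / exp y as y tends to infinity; the factor y is the reason for
  \<open>pCons 0 p\<close>.\<close>

lemma flat_fun_tendsto: "((\<lambda>x. flat_fun p x / x) \<longlongrightarrow> 0) (at 0)"
proof -
  have "((\<lambda>y::real. poly q y / exp y) \<longlongrightarrow> 0) at_top" for q :: "real poly"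
  proof -
    have "((\<lambda>y::real. \<Sum>i\<le>degree q. coeff q i * (y ^ i / exp y)) \<longlongrightarrow> (\<Sum>i\<le>degree q. coeff q i * 0)) at_top"
      by (intro tendsto_sum tendsto_mult tendsto_const tendsto_power_div_exp_0)
    then show ?thesis by (simp add: poly_altdef sum_divide_distrib)
  qed
  then have "((\<lambda>x::real. poly (pCons 0 p) (inverse x) / exp (inverse x)) \<longlongrightarrow> 0) (at_right 0)"
    using filterlim_compose filterlim_inverse_at_top_right by blast
  moreover have "\<forall>\<^sub>F x in at_right 0. poly (pCons 0 p) (inverse x) / exp (inverse x) = flat_fun p x / x"
    by (intro eventually_at_rightI[of 0 1])
       (auto simp: flat_fun_def exp_minus field_simps)
  ultimately have "((\<lambda>x. flat_fun p x / x) \<longlongrightarrow> 0) (at_right 0)"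
    by (rule Lim_transform_eventually)
  moreover have "((\<lambda>x. flat_fun p x / x) \<longlongrightarrow> 0) (at_left 0)"
    by (rule Lim_transform_eventually[OF tendsto_const])
       (auto intro!: eventually_at_leftI[of "-1"] simp: flat_fun_def)
  ultimately show ?thesis by (simp add: filterlim_split_at)
qed

text \<open>With y = 1/x, differentiating p(y) exp(-y) in x gives y^2 (p - p')(y) exp(-y), and
  \<open>[:0, 0, 1:]\<close> is y^2. The point 0, where the two branches meet, is the only one that
  needs the limit above.\<close>

lemma flat_fun_has_derivative:
  "(flat_fun p has_real_derivative flat_fun ([:0, 0, 1:] * (p - pderiv p)) x) (at x)"
proof -
  consider "x > 0" | "x < 0" | "x = 0" by linarith
  then show ?thesis
  proof cases
    case 1
    have "((\<lambda>x. poly p (1 / x) * exp (- 1 / x)) has_real_derivative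
             flat_fun ([:0, 0, 1:] * (p - pderiv p)) x) (at x)"
      using 1 by (auto intro!: derivative_eq_intros poly_DERIV[THEN DERIV_chain2]
          simp: flat_fun_def field_simps power2_eq_square)
    then show ?thesis
      by (rule has_field_derivative_transform_within_open[where S = "{0<..}"])
         (use 1 in \<open>auto simp: flat_fun_def\<close>)
  next
    case 2
    have "((\<lambda>x. 0) has_real_derivative flat_fun ([:0, 0, 1:] * (p - pderiv p)) x) (at x)"
      using 2 by (simp add: flat_fun_def)
    then show ?thesis
      by (rule has_field_derivative_transform_within_open[where S = "{..<0}"])
         (use 2 in \<open>auto simp: flat_fun_def\<close>)
  next
    case 3
    then show ?thesis
      using flat_fun_tendsto[of p] by (simp add: DERIV_def flat_fun_def)
  qed
qed

lemma flat_fun_smooth: "smooth_on UNIV (flat_fun p)"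
proof -
  have "Ck_on k UNIV (flat_fun p)" for k
  proof (induction k arbitrary: p)
    case 0
    show ?case
      unfolding Ck_on.simps(1)
      by (intro continuous_at_imp_continuous_on ballI DERIV_isCont[OF flat_fun_has_derivative])
  next
    case (Suc k)
    show ?case
    proof (rule Ck_on_SucI)
      show "(flat_fun p has_derivative (\<lambda>v. flat_fun ([:0, 0, 1:] * (p - pderiv p)) x * v)) (at x)" for x
        using flat_fun_has_derivative unfolding has_field_derivative_def .
      show "Ck_on k UNIV (\<lambda>x. flat_fun ([:0, 0, 1:] * (p - pderiv p)) x * v)" for v
        by (rule Ck_on_bilinear[OF bounded_bilinear_mult open_UNIV Suc Ck_on_const[OF open_UNIV]])
    qed simp
  qed
  then show ?thesis by (simp add: smooth_on_def)
qed

text \<open>The step is the normalized primitive of a bump that is positive exactly on the open unit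
  interval. The sign of the derivative is part of the result because a monotone reparametrization
  preserves lengths.\<close>

lemma smooth_step_exists:
  obtains \<phi> \<phi>' :: "real \<Rightarrow> real"
  where "smooth_on UNIV \<phi>" "\<And>s. (\<phi> has_real_derivative \<phi>' s) (at s)" "\<And>s. \<phi>' s \<ge> 0"
    "\<And>s. s \<le> 0 \<Longrightarrow> \<phi> s = 0" "\<And>s. s \<ge> 1 \<Longrightarrow> \<phi> s = 1" "\<And>s. 0 \<le> \<phi> s \<and> \<phi> s \<le> 1"
proof -
  define b where "b s = flat_fun 1 s * flat_fun 1 (1 - s)" for s
  from smooth_on_compose[OF open_UNIV subset_UNIV smooth_affine[of "- 1" 1] flat_fun_smooth[of 1]]
  have sm: "smooth_on UNIV b"
    unfolding b_def by (intro smooth_on_mult[OF open_UNIV flat_fun_smooth]) simp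
  have b0: "b s \<ge> 0" for s by (simp add: b_def flat_fun_def)
  have bz: "b s = 0" if "s \<le> 0 \<or> s \<ge> 1" for s using that by (auto simp: b_def flat_fun_def)
  obtain B where B: "\<And>s. (B has_real_derivative b s) (at s)"
    using continuous_has_antiderivative smooth_on_continuous[OF sm] by blast
  have mono: "B x \<le> B y" if "x \<le> y" for x y
    using DERIV_nonneg_imp_nondecreasing[OF that, of B] B b0 by blast
  have cont: "continuous_on I B" for I
    using B DERIV_isCont by (blast intro: continuous_at_imp_continuous_on)
  have low: "B s = B 0" if "s \<le> 0" for s
  proof (cases "s = 0")
    case False
    with that have "s < 0" by simp
    then have "B 0 = B s"
      using bz B by (intro DERIV_isconst_end cont) (metis less_imp_le)+
    then show ?thesis by simp
  qed simp
  have high: "B s = B 1" if "s \<ge> 1" for s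
  proof (cases "s = 1")
    case False
    with that have "1 < s" by simp
    then show ?thesis
      using bz B by (intro DERIV_isconst_end cont) (metis less_imp_le)+
  qed simp
  have "B 0 < B 1"
  proof (rule DERIV_pos_imp_increasing_open[OF zero_less_one _ cont])
    fix x :: real assume "0 < x" "x < 1"
    then have "b x > 0" by (simp add: b_def flat_fun_def)
    then show "\<exists>y. (B has_real_derivative y) (at x) \<and> 0 < y" using B by blast
  qed
  then have pos: "inverse (B 1 - B 0) > 0" by simp
  define \<phi> where "\<phi> s = (B s - B 0) * inverse (B 1 - B 0)" for s
  have der: "(\<phi> has_real_derivative b s * inverse (B 1 - B 0)) (at s)" for s
    unfolding \<phi>_def using B by (auto intro!: derivative_eq_intros)
  show ?thesis
  proof (rule that[of \<phi>, OF _ der])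
    show "smooth_on UNIV \<phi>"
      by (rule smooth_on_antiderivative[OF open_UNIV
            smooth_on_mult[OF open_UNIV sm smooth_on_const[OF open_UNIV]] der])
    show "b s * inverse (B 1 - B 0) \<ge> 0" for s
      using b0 pos by simp
    show "\<phi> s = 0" if "s \<le> 0" for s using low[OF that] by (simp add: \<phi>_def)
    show "\<phi> s = 1" if "s \<ge> 1" for s using high[OF that] \<open>B 0 < B 1\<close> by (simp add: \<phi>_def)
    have "B 0 \<le> B s" "B s \<le> B 1" for s
      using mono[of "min s 0" s] mono[of s "max s 1"] low[of "min s 0"] high[of "max s 1"] by auto
    then show "0 \<le> \<phi> s \<and> \<phi> s \<le> 1" for s
      using \<open>B 0 < B 1\<close> by (simp add: \<phi>_def field_simps)
  qed
qed

section \<open>Tangent vectors and curves in charts\<close>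

locale manifold_atlas =
  fixes A :: "('s::topological_space, 'e::euclidean_space) chart set"
  assumes atlas: "smooth_atlas A"
begin

lemma chart_around: obtains c where "c \<in> A" "p \<in> chart_dom c"
  using atlas unfolding smooth_atlas_def by blast

lemma chart_simps:
  assumes "c \<in> A"
  shows "open (chart_dom c)" "open (chart_img c)"
    and "continuous_on (chart_dom c) (chart_map c)" "continuous_on (chart_img c) (chart_inv c)"
    and "p \<in> chart_dom c \<Longrightarrow> chart_inv c (chart_map c p) = p"
    and "x \<in> chart_img c \<Longrightarrow> chart_map c (chart_inv c x) = x"
    and "x \<in> chart_img c \<Longrightarrow> chart_inv c x \<in> chart_dom c"
  using atlas assms
  by (force simp: smooth_atlas_def is_chart_def homeomorphism_def)+

lemma transition_smooth:
  assumes "c \<in> A" "d \<in> A"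
  shows "smooth_on (chart_map c ` (chart_dom c \<inter> chart_dom d)) (chart_map d \<circ> chart_inv c)"
  using atlas assms by (auto simp: smooth_atlas_def)

lemma overlap_open:
  assumes "c \<in> A" "open U"
  shows "open (chart_map c ` (chart_dom c \<inter> U))"
proof -
  have "chart_map c ` (chart_dom c \<inter> U) = chart_img c \<inter> chart_inv c -` U"
    using chart_simps[OF assms(1)] by (force simp: image_iff)
  then show ?thesis
    using continuous_open_preimage[OF chart_simps(4,2)[OF assms(1)] assms(2)] by simp
qed

lemma transition_has_derivative:
  assumes "c \<in> A" "d \<in> A" "p \<in> chart_dom c" "p \<in> chart_dom d"
  shows "((chart_map d \<circ> chart_inv c) has_derivative
    frechet_derivative (chart_map d \<circ> chart_inv c) (at (chart_map c p))) (at (chart_map c p))"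
  using smooth_on_differentiable[OF transition_smooth[OF assms(1,2)], of "chart_map c p"] assms
  by (auto simp: frechet_derivative_works)

text \<open>The cocycle identity of the transition maps. It makes \<open>tvec_of\<close> satisfy the
  transformation law that defines \<open>tangent_space\<close>.\<close>

lemma transition_chain:
  assumes c: "c \<in> A" "p \<in> chart_dom c" and d: "d \<in> A" "p \<in> chart_dom d" and e: "e \<in> A" "p \<in> chart_dom e"
  shows "frechet_derivative (chart_map e \<circ> chart_inv d) (at (chart_map d p))
           (frechet_derivative (chart_map d \<circ> chart_inv c) (at (chart_map c p)) v)
         = frechet_derivative (chart_map e \<circ> chart_inv c) (at (chart_map c p)) v"
proof -
  let ?De = "frechet_derivative (chart_map e \<circ> chart_inv d) (at (chart_map d p))"
  let ?Dd = "frechet_derivative (chart_map d \<circ> chart_inv c) (at (chart_map c p))"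
  let ?x = "chart_map c p"
  have "((chart_map d \<circ> chart_inv c) has_derivative ?Dd) (at ?x)"
    by (rule transition_has_derivative) (use c d in auto)
  moreover have "((chart_map e \<circ> chart_inv d) has_derivative ?De) (at ((chart_map d \<circ> chart_inv c) ?x))"
    using transition_has_derivative[OF d(1) e(1) d(2) e(2)] chart_simps(5)[OF c] by simp
  ultimately have "((chart_map e \<circ> chart_inv d) \<circ> (chart_map d \<circ> chart_inv c) has_derivative ?De \<circ> ?Dd) (at ?x)"
    by (rule diff_chain_at)
  then have "((chart_map e \<circ> chart_inv c) has_derivative ?De \<circ> ?Dd) (at ?x)"
    by (rule has_derivative_transform_within_open[OF _ overlap_open[OF c(1) chart_simps(1)[OF d(1)]]])
       (use c d chart_simps[OF c(1)] chart_simps[OF d(1)] in auto)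
  from frechet_derivative_at[OF this] show ?thesis
    by (simp add: fun_eq_iff)
qed

lemma tvec_of_tangent:
  assumes "c \<in> A" "p \<in> chart_dom c"
  shows "tvec_of A p c v \<in> tangent_space A p"
  unfolding tangent_space_def
proof (intro CollectI conjI allI ballI impI)
  fix d e assume "d \<in> A" "e \<in> A" "p \<in> chart_dom d" "p \<in> chart_dom e"
  then show "tvec_of A p c v e
      = frechet_derivative (chart_map e \<circ> chart_inv d) (at (chart_map d p)) (tvec_of A p c v d)"
    unfolding tvec_of_def using transition_chain[OF assms, of d e v] by simp
qed (auto simp: tvec_of_def)

lemma tangent_eq_tvec_of:
  assumes "c \<in> A" "p \<in> chart_dom c" "X \<in> tangent_space A p"
  shows "X = tvec_of A p c (X c)"
proof
  fix d
  note X = assms(3)[unfolded tangent_space_def mem_Collect_eq]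
  show "X d = tvec_of A p c (X c) d"
  proof (cases "d \<in> A \<and> p \<in> chart_dom d")
    case True
    then show ?thesis
      using X[THEN conjunct2, rule_format, OF assms(1) _ assms(2), of d] by (simp add: tvec_of_def)
  next
    case False
    then show ?thesis
      using X[THEN conjunct1, rule_format, of d] by (auto simp: tvec_of_def)
  qed
qed

lemma tvec_of_linear:
  assumes "c \<in> A" "p \<in> chart_dom c"
  shows "tvec_of A p c (a *\<^sub>R v + b *\<^sub>R w) = (\<lambda>d. a *\<^sub>R tvec_of A p c v d + b *\<^sub>R tvec_of A p c w d)"
proof
  fix d
  show "tvec_of A p c (a *\<^sub>R v + b *\<^sub>R w) d = a *\<^sub>R tvec_of A p c v d + b *\<^sub>R tvec_of A p c w d"
  proof (cases "d \<in> A \<and> p \<in> chart_dom d")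
    case True
    then have "linear (frechet_derivative (chart_map d \<circ> chart_inv c) (at (chart_map c p)))"
      using has_derivative_linear[OF transition_has_derivative[OF assms(1) _ assms(2)]] by blast
    then show ?thesis
      using True by (simp add: tvec_of_def linear_add linear_scale)
  qed (auto simp: tvec_of_def)
qed

lemma linear_form_linear:
  assumes "c \<in> A" "p \<in> chart_dom c" "linear_form_at A p \<alpha>"
  shows "linear (\<lambda>v. \<alpha> (tvec_of A p c v))"
proof -
  have *: "\<alpha> (tvec_of A p c (a *\<^sub>R v + b *\<^sub>R w)) = a * \<alpha> (tvec_of A p c v) + b * \<alpha> (tvec_of A p c w)" for a b v w
    using assms(3) tvec_of_tangent[OF assms(1,2)]
    unfolding tvec_of_linear[OF assms(1,2)] linear_form_at_def by blast
  show ?thesis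
    using *[of 1 _ 1] *[of _ _ 0] by (intro linearI) auto
qed

lemma linear_form_expand:
  assumes "c \<in> A" "p \<in> chart_dom c" "linear_form_at A p \<alpha>"
  shows "\<alpha> (tvec_of A p c v) = (\<Sum>b\<in>Basis. (v \<bullet> b) * \<alpha> (tvec_of A p c b))"
proof -
  note lin = linear_form_linear[OF assms]
  have "\<alpha> (tvec_of A p c v) = \<alpha> (tvec_of A p c (\<Sum>b\<in>Basis. (v \<bullet> b) *\<^sub>R b))"
    by (simp add: euclidean_representation)
  also have "\<dots> = (\<Sum>b\<in>Basis. (v \<bullet> b) * \<alpha> (tvec_of A p c b))"
    using linear_sum[OF lin, of "\<lambda>b. (v \<bullet> b) *\<^sub>R b" Basis] linear_scale[OF lin] by simp
  finally show ?thesis .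
qed

section \<open>Smooth curves and their velocities\<close>

lemma smooth_curve_on_subset:
  "smooth_curve_on A I \<gamma> \<Longrightarrow> J \<subseteq> I \<Longrightarrow> smooth_curve_on A J \<gamma>"
  unfolding smooth_curve_on_def
  by (auto intro: continuous_on_subset smooth_on_subset)

lemma curve_preimage_open:
  assumes "open I" "continuous_on I \<gamma>" "c \<in> A"
  shows "open (I \<inter> \<gamma> -` chart_dom c)"
  using continuous_open_preimage[OF assms(2,1) chart_simps(1)[OF assms(3)]] .

text \<open>The local model \<open>\<delta>\<close> may change from one parameter to the next; this
  is how a concatenation, given by a different piece near each parameter, is seen to be
  smooth.\<close>

lemma smooth_curve_onI:
  assumes "open I"
    and "\<And>s. s \<in> I \<Longrightarrow> \<exists>U \<delta>. open U \<and> s \<in> U \<and> smooth_curve_on A U \<delta> \<and> (\<forall>t\<in>U. \<gamma> t = \<delta> t)"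
  shows "smooth_curve_on A I \<gamma>"
proof -
  have cont: "isCont \<gamma> s" if "s \<in> I" for s
  proof -
    from assms(2)[OF that] obtain U \<delta>
      where U: "open U" "s \<in> U" "smooth_curve_on A U \<delta>" "\<forall>t\<in>U. \<gamma> t = \<delta> t" by blast
    from U(3) have "continuous_on U \<delta>" unfolding smooth_curve_on_def by blast
    with U(4) have "continuous_on U \<gamma>" using continuous_on_eq[of U \<delta> \<gamma>] by metis
    then show ?thesis using continuous_on_eq_continuous_at[OF U(1)] U(2) by blast
  qed
  then have cI: "continuous_on I \<gamma>"
    by (simp add: continuous_at_imp_continuous_on)
  have "smooth_on (I \<inter> \<gamma> -` chart_dom c) (chart_map c \<circ> \<gamma>)" if c: "c \<in> A" for c
  proof (rule smooth_on_local)
    fix s assume s: "s \<in> I \<inter> \<gamma> -` chart_dom c"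
    from assms(2)[of s] s obtain U \<delta>
      where U: "open U" "s \<in> U" "smooth_curve_on A U \<delta>" "\<forall>t\<in>U. \<gamma> t = \<delta> t" by blast
    let ?V = "U \<inter> \<delta> -` chart_dom c"
    have V: "open ?V" using curve_preimage_open[OF U(1) _ c] U(3) by (auto simp: smooth_curve_on_def)
    have "smooth_on ?V (chart_map c \<circ> \<delta>)" using U(3) c by (auto simp: smooth_curve_on_def)
    then have "smooth_on ?V (chart_map c \<circ> \<gamma>)"
      using smooth_on_cong[OF V, of "chart_map c \<circ> \<gamma>" "chart_map c \<circ> \<delta>"] U(4) by auto
    then show "\<exists>V. open V \<and> s \<in> V \<and> smooth_on V (chart_map c \<circ> \<gamma>)"
      using V U s by (intro exI[of _ ?V]) auto
  qed
  then show ?thesis using cI by (auto simp: smooth_curve_on_def)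
qed

lemma smooth_curve_on_compose:
  assumes "smooth_curve_on A J \<delta>" "smooth_on I \<psi>" "open I" "\<psi> ` I \<subseteq> J"
  shows "smooth_curve_on A I (\<lambda>s. \<delta> (\<psi> s))"
proof -
  have cont: "continuous_on I (\<lambda>s. \<delta> (\<psi> s))"
    using assms(1) unfolding smooth_curve_on_def
    by (intro continuous_on_compose2[OF _ smooth_on_continuous[OF assms(2)] assms(4)]) blast
  have "smooth_on (I \<inter> (\<lambda>s. \<delta> (\<psi> s)) -` chart_dom c) (chart_map c \<circ> (\<lambda>s. \<delta> (\<psi> s)))"
    if c: "c \<in> A" for c
  proof -
    have "smooth_on (J \<inter> \<delta> -` chart_dom c) (chart_map c \<circ> \<delta>)"
      using assms(1) c unfolding smooth_curve_on_def by blast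
    then have "smooth_on (I \<inter> (\<lambda>s. \<delta> (\<psi> s)) -` chart_dom c) (\<lambda>s. (chart_map c \<circ> \<delta>) (\<psi> s))"
      by (rule smooth_on_compose[OF curve_preimage_open[OF assms(3) cont c] _ smooth_on_subset[OF assms(2)], rotated 2])
         (use assms(4) in auto)
    then show ?thesis by (simp add: comp_def)
  qed
  then show ?thesis using cont by (auto simp: smooth_curve_on_def)
qed

lemma smooth_curve_on_const: "smooth_curve_on A UNIV (\<lambda>s. p)"
  unfolding smooth_curve_on_def comp_def
  using curve_preimage_open[OF open_UNIV continuous_on_const, of _ p]
  by (auto intro!: smooth_on_const continuous_on_const)

lemma smooth_curve_on_chart_inv:
  assumes "c \<in> A" "open I" "smooth_on I f" "f ` I \<subseteq> chart_img c"
  shows "smooth_curve_on A I (\<lambda>s. chart_inv c (f s))"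
proof -
  have cont: "continuous_on I (\<lambda>s. chart_inv c (f s))"
    by (rule continuous_on_compose2[OF chart_simps(4)[OF assms(1)] smooth_on_continuous[OF assms(3)] assms(4)])
  have "smooth_on (I \<inter> (\<lambda>s. chart_inv c (f s)) -` chart_dom d) (chart_map d \<circ> (\<lambda>s. chart_inv c (f s)))"
    if d: "d \<in> A" for d
  proof -
    have "f s \<in> chart_map c ` (chart_dom c \<inter> chart_dom d)" if "s \<in> I" "chart_inv c (f s) \<in> chart_dom d" for s
      using that assms(4) chart_simps(6,7)[OF assms(1), of "f s"] by (force simp: image_iff)
    then have "f ` (I \<inter> (\<lambda>s. chart_inv c (f s)) -` chart_dom d) \<subseteq> chart_map c ` (chart_dom c \<inter> chart_dom d)"
      by blast
    from smooth_on_compose[OF curve_preimage_open[OF assms(2) cont d] this smooth_on_subset[OF assms(3)]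
        transition_smooth[OF assms(1) d]]
    have "smooth_on (I \<inter> (\<lambda>s. chart_inv c (f s)) -` chart_dom d) (\<lambda>s. (chart_map d \<circ> chart_inv c) (f s))"
      by blast
    then show ?thesis by (simp add: comp_def)
  qed
  then show ?thesis using cont by (auto simp: smooth_curve_on_def)
qed

lemma curve_has_vector_derivative:
  assumes "smooth_curve_on A I \<gamma>" "s \<in> I" "c \<in> A" "\<gamma> s \<in> chart_dom c"
  shows "((chart_map c \<circ> \<gamma>) has_vector_derivative velocity A \<gamma> s c) (at s)"
proof -
  have "(chart_map c \<circ> \<gamma>) differentiable (at s)"
    using assms smooth_on_differentiable[of "I \<inter> \<gamma> -` chart_dom c" "chart_map c \<circ> \<gamma>" s]
    by (auto simp: smooth_curve_on_def)
  then show ?thesis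
    using assms by (simp add: velocity_def vector_derivative_works[symmetric])
qed

text \<open>By the chain rule the velocity components in different charts obey the transformation
  law, so a computation in one chart determines the whole vector.\<close>

lemma velocity_eq_tvec_of:
  assumes "open I" "smooth_curve_on A I \<gamma>" "s \<in> I" "c \<in> A" "\<gamma> s \<in> chart_dom c"
  shows "velocity A \<gamma> s = tvec_of A (\<gamma> s) c (vector_derivative (chart_map c \<circ> \<gamma>) (at s))"
proof
  fix d
  show "velocity A \<gamma> s d = tvec_of A (\<gamma> s) c (vector_derivative (chart_map c \<circ> \<gamma>) (at s)) d"
  proof (cases "d \<in> A \<and> \<gamma> s \<in> chart_dom d")
    case True
    let ?D = "frechet_derivative (chart_map d \<circ> chart_inv c) (at (chart_map c (\<gamma> s)))"
    have c: "((chart_map c \<circ> \<gamma>) has_vector_derivative velocity A \<gamma> s c) (at s)"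
      by (rule curve_has_vector_derivative[OF assms(2-5)])
    have "(chart_map d \<circ> chart_inv c has_derivative ?D) (at ((chart_map c \<circ> \<gamma>) s))"
      using transition_has_derivative[OF assms(4) _ assms(5)] True by simp
    from vector_derivative_diff_chain_within[OF c has_derivative_at_withinI[OF this]]
    have "((chart_map d \<circ> chart_inv c) \<circ> (chart_map c \<circ> \<gamma>) has_vector_derivative ?D (velocity A \<gamma> s c)) (at s)"
      by (simp add: comp_def)
    then have "((chart_map d \<circ> \<gamma>) has_vector_derivative ?D (velocity A \<gamma> s c)) (at s)"
    proof (rule has_vector_derivative_transform_within_open)
      show "open (I \<inter> \<gamma> -` chart_dom c)"
        using curve_preimage_open[OF assms(1) _ assms(4)] assms(2) by (auto simp: smooth_curve_on_def)
    qed (use assms chart_simps[OF assms(4)] in auto)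
    from vector_derivative_at[OF this] show ?thesis
      using True assms by (simp add: velocity_def tvec_of_def)
  qed (auto simp: velocity_def tvec_of_def)
qed

lemma velocity_tangent:
  assumes "open I" "smooth_curve_on A I \<gamma>" "s \<in> I"
  shows "velocity A \<gamma> s \<in> tangent_space A (\<gamma> s)"
proof -
  obtain c where c: "c \<in> A" "\<gamma> s \<in> chart_dom c" by (rule chart_around)
  then show ?thesis using velocity_eq_tvec_of[OF assms c] tvec_of_tangent[OF c] by simp
qed

lemma velocity_cong:
  assumes "open U" "s \<in> U" "\<And>t. t \<in> U \<Longrightarrow> \<gamma> t = \<delta> t"
  shows "velocity A \<gamma> s = velocity A \<delta> s"
proof -
  have "((f \<circ> \<gamma>) has_vector_derivative D) (at s) \<longleftrightarrow> ((f \<circ> \<delta>) has_vector_derivative D) (at s)"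
    for f :: "'s \<Rightarrow> 'e" and D
    unfolding has_vector_derivative_def
    by (rule has_derivative_cong_open[OF assms(1,2)]) (simp add: assms(3))
  then have "vector_derivative (f \<circ> \<gamma>) (at s) = vector_derivative (f \<circ> \<delta>) (at s)" for f :: "'s \<Rightarrow> 'e"
    unfolding vector_derivative_def by simp
  then show ?thesis
    using assms(3)[OF assms(2)] by (simp add: velocity_def cong: if_cong)
qed

lemma velocity_compose:
  assumes "smooth_curve_on A J \<delta>" "\<psi> s \<in> J" "(\<psi> has_real_derivative D) (at s)"
  shows "velocity A (\<lambda>s. \<delta> (\<psi> s)) s = (\<lambda>c. D *\<^sub>R velocity A \<delta> (\<psi> s) c)"
proof
  fix c
  show "velocity A (\<lambda>s. \<delta> (\<psi> s)) s c = D *\<^sub>R velocity A \<delta> (\<psi> s) c"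
  proof (cases "c \<in> A \<and> \<delta> (\<psi> s) \<in> chart_dom c")
    case True
    then have "((chart_map c \<circ> \<delta>) has_vector_derivative velocity A \<delta> (\<psi> s) c) (at (\<psi> s))"
      using curve_has_vector_derivative[OF assms(1,2)] by blast
    from vector_derivative_at[OF vector_diff_chain_at[OF assms(3)[unfolded has_real_derivative_iff_has_vector_derivative] this]]
    show ?thesis using True by (simp add: velocity_def comp_def)
  qed (auto simp: velocity_def)
qed

lemma velocity_const: "velocity A (\<lambda>s. p) s = (\<lambda>c. 0)"
  by (auto simp: velocity_def comp_def)


end

section \<open>Speed and concatenation of curves\<close>

locale riemannian_manifold = manifold_atlas A
  for A :: "('s::topological_space, 'e::euclidean_space) chart set" +
  fixes h :: "('s, 'e) tensor2"
  assumes metric: "riemannian_metric A h"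
begin

section \<open>Pointwise algebra of the metric and its smoothness along curves\<close>

lemma metric_linear: "X \<in> tangent_space A p \<Longrightarrow> linear_form_at A p (h p X)"
  and metric_sym: "X \<in> tangent_space A p \<Longrightarrow> Y \<in> tangent_space A p \<Longrightarrow> h p X Y = h p Y X"
  and metric_pos: "X \<in> tangent_space A p \<Longrightarrow> X \<noteq> (\<lambda>_. 0) \<Longrightarrow> h p X X > 0"
  and metric_smooth: "c \<in> A \<Longrightarrow> smooth_on (chart_img c)
        (\<lambda>x. h (chart_inv c x) (tvec_of A (chart_inv c x) c v) (tvec_of A (chart_inv c x) c w))"
  using metric by (auto simp: riemannian_metric_def)

lemma tangent_scale:
  assumes "X \<in> tangent_space A p"
  shows "(\<lambda>c. a *\<^sub>R X c) \<in> tangent_space A p"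
proof -
  obtain c where c: "c \<in> A" "p \<in> chart_dom c" by (rule chart_around)
  have "tvec_of A p c (a *\<^sub>R X c) = (\<lambda>d. a *\<^sub>R tvec_of A p c (X c) d)"
    using tvec_of_linear[OF c, of a "X c" 0 0] by simp
  also have "\<dots> = (\<lambda>d. a *\<^sub>R X d)"
    unfolding tangent_eq_tvec_of[OF c assms, symmetric] ..
  finally show ?thesis
    using tvec_of_tangent[OF c] by metis
qed

lemma metric_scale_right:
  assumes "X \<in> tangent_space A p" "Y \<in> tangent_space A p"
  shows "h p X (\<lambda>c. a *\<^sub>R Y c) = a * h p X Y"
  using metric_linear[OF assms(1), unfolded linear_form_at_def, rule_format, OF assms(2) assms(2), of a 0]
  by simp

lemma metric_scale:
  assumes "X \<in> tangent_space A p"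
  shows "h p (\<lambda>c. a *\<^sub>R X c) (\<lambda>c. a *\<^sub>R X c) = a\<^sup>2 * h p X X"
  using metric_scale_right[OF tangent_scale[OF assms] assms] metric_scale_right[OF assms assms]
    metric_sym[OF tangent_scale[OF assms] assms] by (simp add: power2_eq_square)

lemma metric_zero: "h p (\<lambda>_. 0) (\<lambda>_. 0) = 0"
proof -
  obtain c where c: "c \<in> A" "p \<in> chart_dom c" by (rule chart_around)
  show ?thesis
    using metric_scale[OF tvec_of_tangent[OF c, of 0], of 0] by simp
qed

lemma metric_nonneg:
  assumes "X \<in> tangent_space A p" shows "h p X X \<ge> 0"
proof (cases "X = (\<lambda>_. 0)")
  case True
  then show ?thesis using metric_zero[of p] by simp
next
  case False
  then show ?thesis using metric_pos[OF assms] by simp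
qed

text \<open>The definition of a metric gives linearity in the second argument, transferred to the
  first by symmetry, and smoothness for constant component vectors only. The expansion reduces
  varying velocities to that case.\<close>

lemma metric_expand:
  assumes "c \<in> A" "p \<in> chart_dom c"
  shows "h p (tvec_of A p c v) (tvec_of A p c v) =
    (\<Sum>i\<in>Basis. (v \<bullet> i) * (\<Sum>j\<in>Basis. (v \<bullet> j) * h p (tvec_of A p c i) (tvec_of A p c j)))"
proof -
  note T = tvec_of_tangent[OF assms]
  have "h p (tvec_of A p c v) (tvec_of A p c v) = (\<Sum>i\<in>Basis. (v \<bullet> i) * h p (tvec_of A p c v) (tvec_of A p c i))"
    by (rule linear_form_expand[OF assms metric_linear[OF T]])
  also have "\<dots> = (\<Sum>i\<in>Basis. (v \<bullet> i) * h p (tvec_of A p c i) (tvec_of A p c v))"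
    by (simp add: metric_sym[OF T T, of v])
  also have "\<dots> = (\<Sum>i\<in>Basis. (v \<bullet> i) * (\<Sum>j\<in>Basis. (v \<bullet> j) * h p (tvec_of A p c i) (tvec_of A p c j)))"
    by (simp only: linear_form_expand[OF assms metric_linear[OF T], of _ v])
  finally show ?thesis .
qed

text \<open>Stated for the squared speed: its root may fail to be smooth where the velocity
  vanishes.\<close>

lemma metric_along_smooth:
  assumes "open I" "smooth_curve_on A I \<gamma>"
  shows "smooth_on I (\<lambda>s. h (\<gamma> s) (velocity A \<gamma> s) (velocity A \<gamma> s))"
proof (rule smooth_on_local)
  fix s assume s: "s \<in> I"
  obtain c where c: "c \<in> A" "\<gamma> s \<in> chart_dom c" by (rule chart_around)
  define U where "U = I \<inter> \<gamma> -` chart_dom c"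
  have U: "open U" "s \<in> U" "U \<subseteq> I"
    using curve_preimage_open[OF assms(1) _ c(1)] assms(2) s c(2) by (auto simp: smooth_curve_on_def U_def)
  have sm: "smooth_on U (\<lambda>t. chart_map c (\<gamma> t))"
    using assms(2) c(1) unfolding smooth_curve_on_def U_def comp_def by blast
  define v where "v t = vector_derivative (\<lambda>t. chart_map c (\<gamma> t)) (at t)" for t
  have smv: "smooth_on U v"
    unfolding v_def by (rule smooth_on_vector_derivative[OF U(1) sm])
  define G where "G i j x = h (chart_inv c x) (tvec_of A (chart_inv c x) c i) (tvec_of A (chart_inv c x) c j)" for i j x
  have smvi: "smooth_on U (\<lambda>t. v t \<bullet> i)" for i
    by (rule smooth_on_linear[OF bounded_linear_inner_left U(1) smv])
  have smG: "smooth_on U (\<lambda>t. G i j (chart_map c (\<gamma> t)))" for i j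
    using metric_smooth[OF c(1), of i j]
    by (intro smooth_on_compose[OF U(1) _ sm, of "chart_img c"]) (auto simp: U_def G_def)
  have "smooth_on U (\<lambda>t. \<Sum>i\<in>Basis. (v t \<bullet> i) * (\<Sum>j\<in>Basis. (v t \<bullet> j) * G i j (chart_map c (\<gamma> t))))"
    by (intro smooth_on_sum[OF U(1)] smooth_on_mult[OF U(1)] smvi smG)
  moreover have "h (\<gamma> t) (velocity A \<gamma> t) (velocity A \<gamma> t)
      = (\<Sum>i\<in>Basis. (v t \<bullet> i) * (\<Sum>j\<in>Basis. (v t \<bullet> j) * G i j (chart_map c (\<gamma> t))))" if "t \<in> U" for t
  proof -
    have t: "t \<in> I" "\<gamma> t \<in> chart_dom c" using that by (auto simp: U_def)
    show ?thesis
      unfolding velocity_eq_tvec_of[OF assms t(1) c(1) t(2)] metric_expand[OF c(1) t(2)]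
      by (simp add: v_def G_def comp_def chart_simps(5)[OF c(1) t(2)])
  qed
  ultimately have "smooth_on U (\<lambda>s. h (\<gamma> s) (velocity A \<gamma> s) (velocity A \<gamma> s))"
    using smooth_on_cong[OF U(1), of "\<lambda>s. h (\<gamma> s) (velocity A \<gamma> s) (velocity A \<gamma> s)"] by simp
  then show "\<exists>U. open U \<and> s \<in> U \<and> smooth_on U (\<lambda>s. h (\<gamma> s) (velocity A \<gamma> s) (velocity A \<gamma> s))"
    using U by blast
qed

section \<open>Speed, reparametrization and concatenation\<close>

definition speed :: "(real \<Rightarrow> 's) \<Rightarrow> real \<Rightarrow> real" where
  "speed \<gamma> s = sqrt (h (\<gamma> s) (velocity A \<gamma> s) (velocity A \<gamma> s))"

lemma curve_length_speed: "curve_length A h a b \<gamma> = integral {a..b} (speed \<gamma>)"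
  by (simp add: curve_length_def speed_def[abs_def])

lemma speed_nonneg: "open I \<Longrightarrow> smooth_curve_on A I \<gamma> \<Longrightarrow> s \<in> I \<Longrightarrow> speed \<gamma> s \<ge> 0"
  by (simp add: speed_def metric_nonneg velocity_tangent)

lemma speed_continuous:
  assumes "open I" "smooth_curve_on A I \<gamma>"
  shows "continuous_on I (speed \<gamma>)"
  unfolding speed_def[abs_def]
  by (rule continuous_on_real_sqrt[OF smooth_on_continuous[OF metric_along_smooth[OF assms]]])

lemma speed_cong:
  assumes "open U" "s \<in> U" "\<And>t. t \<in> U \<Longrightarrow> \<gamma> t = \<delta> t"
  shows "speed \<gamma> s = speed \<delta> s"
  using velocity_cong[OF assms] assms(3)[OF assms(2)] by (simp add: speed_def)

lemma speed_const: "speed (\<lambda>_. p) s = 0"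
  by (simp add: speed_def velocity_const metric_zero)

lemma speed_compose:
  assumes "open J" "smooth_curve_on A J \<delta>" "\<psi> s \<in> J" "(\<psi> has_real_derivative D) (at s)" "D \<ge> 0"
  shows "speed (\<lambda>s. \<delta> (\<psi> s)) s = D * speed \<delta> (\<psi> s)"
  unfolding speed_def velocity_compose[OF assms(2-4)] metric_scale[OF velocity_tangent[OF assms(1-3)]]
  using assms(5) by (simp add: real_sqrt_mult)

text \<open>Curves that stand still outside \<open>{0..1}\<close> can be concatenated without losing smoothness.\<close>

definition flat_curve :: "(real \<Rightarrow> 's) \<Rightarrow> 's \<Rightarrow> 's \<Rightarrow> real \<Rightarrow> bool" where
  "flat_curve c x y l \<longleftrightarrow> smooth_curve_on A UNIV c \<and> (\<forall>s\<le>0. c s = x) \<and> (\<forall>s\<ge>1. c s = y) \<and>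
     (speed c has_integral l) {0..1}"

lemma flat_curve_const: "flat_curve (\<lambda>_. x) x x 0"
  by (simp add: flat_curve_def smooth_curve_on_const speed_const[abs_def])

lemma flat_curve_nonneg: "flat_curve c x y l \<Longrightarrow> l \<ge> 0"
  using speed_nonneg[OF open_UNIV, of c] by (auto simp: flat_curve_def intro: has_integral_nonneg)

lemma smooth_curve_affine:
  "smooth_curve_on A UNIV c \<Longrightarrow> smooth_curve_on A UNIV (\<lambda>s. c (k * s + m))"
  by (rule smooth_curve_on_compose[OF _ smooth_affine open_UNIV]) auto

lemma speed_affine:
  assumes "smooth_curve_on A UNIV c" "k \<ge> 0"
  shows "speed (\<lambda>s. c (k * s + m)) s = k * speed c (k * s + m)"
  by (rule speed_compose[OF open_UNIV assms(1) UNIV_I _ assms(2)]) (auto intro!: derivative_eq_intros)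

lemma speed_affine_has_integral:
  assumes "smooth_curve_on A UNIV c" "k \<ge> 0" "a \<le> b"
    and "(speed c has_integral l) {k * a + m..k * b + m}"
  shows "(speed (\<lambda>s. c (k * s + m)) has_integral l) {a..b}"
proof -
  have "((\<lambda>s. k *\<^sub>R speed c (k * s + m)) has_integral integral {k * a + m..k * b + m} (speed c)) {a..b}"
  proof (rule has_integral_substitution[where c = "k * a + m" and d = "k * b + m"])
    show "continuous_on {k * a + m..k * b + m} (speed c)"
      using continuous_on_subset[OF speed_continuous[OF open_UNIV assms(1)]] by blast
  qed (use assms in \<open>auto intro!: derivative_eq_intros mult_left_mono\<close>)
  then show ?thesis
    unfolding speed_affine[OF assms(1,2), abs_def] using integral_unique[OF assms(4)] by simp
qed

text \<open>The factor 2 makes consecutive pieces overlap in an interval on which both are constant.\<close>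

definition concat_curve :: "(nat \<Rightarrow> real \<Rightarrow> 's) \<Rightarrow> real \<Rightarrow> 's" where
  "concat_curve c s = c (nat \<lfloor>s\<rfloor>) (2 * s + - 2 * real (nat \<lfloor>s\<rfloor>))"

lemma concat_curve:
  assumes "\<And>n. flat_curve (c n) (x n) (x (Suc n)) (l n)"
  shows "smooth_curve_on A UNIV (concat_curve c)"
    and "concat_curve c (real n) = x n"
    and "(speed (concat_curve c) has_integral l n) {real n..real (Suc n)}"
proof -
  have sm: "smooth_curve_on A UNIV (c n)" for n using assms by (simp add: flat_curve_def)
  have low: "c n s = x n" if "s \<le> 0" for n s using assms that by (simp add: flat_curve_def)
  have high: "c n s = x (Suc n)" if "s \<ge> 1" for n s using assms that by (simp add: flat_curve_def)
  \<comment> \<open>Piece \<open>n\<close> moves during the first half of its unit interval and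
    rests during the second. Between n - 1/2 and n both neighbouring pieces stay at
    \<open>x n\<close>, so piece \<open>n\<close> alone describes the curve on \<open>U n\<close>.
    As \<open>nat\<close> sends negative floors to 0, piece 0 also serves all negative parameters,
    where it rests at \<open>x 0\<close>.\<close>
  define U where "U n = {s::real. s < real n + 1 \<and> (n = 0 \<or> s > real n - 1/2)}" for n
  have U: "open (U n)" for n
  proof (cases "n = 0")
    case True
    then have "U n = {..<1}" by (auto simp: U_def)
    then show ?thesis by simp
  next
    case False
    then have "U n = {real n - 1/2<..<real n + 1}" by (auto simp: U_def)
    then show ?thesis by simp
  qed
  have eq: "concat_curve c s = c n (2 * s + - 2 * real n)" if "s \<in> U n" for n s
  proof -
    consider "s \<ge> real n" | "s < real n" "n \<noteq> 0" | "n = 0" "s < 0"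
      using not_le by fastforce
    then show ?thesis
    proof cases
      case 1
      then have "\<lfloor>s\<rfloor> = int n" using that by (auto simp: U_def intro!: floor_unique)
      then show ?thesis by (simp add: concat_curve_def)
    next
      case 2
      then obtain m where m: "n = Suc m" by (cases n) auto
      have "\<lfloor>s\<rfloor> = int m" using that 2 m by (auto simp: U_def intro!: floor_unique)
      then show ?thesis using that 2 m by (simp add: concat_curve_def U_def low high)
    next
      case 3
      then show ?thesis by (simp add: concat_curve_def)
    qed
  qed
  show "smooth_curve_on A UNIV (concat_curve c)"
  proof (rule smooth_curve_onI[OF open_UNIV])
    fix s :: real
    have "s \<in> U (nat \<lfloor>s\<rfloor>)"
      unfolding U_def by (cases "s \<ge> 0") (auto, linarith+)
    moreover have "smooth_curve_on A (U n) (\<lambda>s. c n (2 * s + - 2 * real n))" for n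
      by (rule smooth_curve_on_subset[OF smooth_curve_affine[OF sm] subset_UNIV])
    ultimately show "\<exists>V \<delta>. open V \<and> s \<in> V \<and> smooth_curve_on A V \<delta> \<and> (\<forall>t\<in>V. concat_curve c t = \<delta> t)"
      using U eq by meson
  qed
  show "concat_curve c (real n) = x n" by (simp add: concat_curve_def low)
  have zero: "speed (c n) s = 0" if "s > 1" for s
  proof -
    have "speed (c n) s = speed (\<lambda>_. x (Suc n)) s"
      by (rule speed_cong[of "{1<..}"]) (use that high in auto)
    then show ?thesis by (simp add: speed_const)
  qed
  \<comment> \<open>The doubled parameter of piece \<open>n\<close> runs through an interval of
    length 2, and its second half contributes nothing.\<close>
  have "(speed (c n) has_integral l n) {0..2}"
  proof (rule has_integral_combine[of 0 1 2 _ "l n" 0, simplified])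
    show "(speed (c n) has_integral l n) {0..1}" using assms by (simp add: flat_curve_def)
    show "(speed (c n) has_integral 0) {1..2}"
      by (rule has_integral_spike_finite[of "{1}" _ _ "\<lambda>_. 0"]) (use zero in auto)
  qed
  then have "(speed (\<lambda>s. c n (2 * s + - 2 * real n)) has_integral l n) {real n..real (Suc n)}"
    by (intro speed_affine_has_integral[OF sm]) auto
  then show "(speed (concat_curve c) has_integral l n) {real n..real (Suc n)}"
  proof (rule has_integral_spike_finite[of "{real (Suc n)}", rotated 2])
    fix s assume "s \<in> {real n..real (Suc n)} - {real (Suc n)}"
    then have "s \<in> U n" by (auto simp: U_def)
    then show "speed (concat_curve c) s = speed (\<lambda>s. c n (2 * s + - 2 * real n)) s"
      by (rule speed_cong[OF U]) (rule eq)
  qed simp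
qed

definition flat_path :: "'s \<Rightarrow> 's \<Rightarrow> real \<Rightarrow> bool" where
  "flat_path x y l \<longleftrightarrow> (\<exists>c. flat_curve c x y l)"

text \<open>Two pieces followed by constant ones form an infinite concatenation; the interval from 0
  to 2 is then compressed to the unit interval.\<close>

lemma flat_path_trans:
  assumes "flat_path x y l" "flat_path y z l'"
  shows "flat_path x z (l + l')"
proof -
  obtain c1 c2 where c: "flat_curve c1 x y l" "flat_curve c2 y z l'"
    using assms by (auto simp: flat_path_def)
  define cs where "cs n = (if n = 0 then c1 else if n = 1 then c2 else (\<lambda>_. z))" for n :: nat
  define xs where "xs n = (if n = 0 then x else if n = 1 then y else z)" for n :: nat
  define ls where "ls n = (if n = 0 then l else if n = 1 then l' else 0)" for n :: nat
  have "flat_curve (cs n) (xs n) (xs (Suc n)) (ls n)" for n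
    using c flat_curve_const[of z] by (auto simp: cs_def xs_def ls_def)
  note C = concat_curve[of cs xs ls, OF this]
  have "(speed (concat_curve cs) has_integral ls 0 + ls 1) {0..2}"
    using has_integral_combine[of 0 1 2 "speed (concat_curve cs)" "ls 0" "ls 1"] C(3)[of 0] C(3)[of 1] by simp
  then have "(speed (\<lambda>s. concat_curve cs (2 * s + 0)) has_integral l + l') {0..1}"
    by (intro speed_affine_has_integral[OF C(1)]) (auto simp: ls_def)
  moreover have "concat_curve cs (2 * s + 0) = x" if "s \<le> 0" for s
    using that c(1) by (simp add: concat_curve_def cs_def flat_curve_def)
  moreover have "concat_curve cs (2 * s + 0) = z" if "s \<ge> 1" for s
  proof -
    have "\<lfloor>2 * s\<rfloor> \<ge> 2" using that by (simp add: le_floor_iff)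
    then have "nat \<lfloor>2 * s\<rfloor> \<noteq> 0" "nat \<lfloor>2 * s\<rfloor> \<noteq> 1" by linarith+
    then show ?thesis by (simp add: concat_curve_def cs_def)
  qed
  ultimately have "flat_curve (\<lambda>s. concat_curve cs (2 * s + 0)) x z (l + l')"
    using smooth_curve_affine[OF C(1), of 2 0] by (simp add: flat_curve_def)
  then show ?thesis unfolding flat_path_def by blast
qed

end

section \<open>Riemannian distance through flat curves\<close>

context riemannian_manifold begin

text \<open>Precomposition with a step function from \<open>u\<close> to \<open>v\<close> keeps the
  length and makes the curve rest outside the unit interval. It is applied to the extension
  \<open>\<delta>\<close>, which is smooth around the endpoints, and only sees the part of
  \<open>\<delta>\<close> that agrees with \<open>\<gamma>\<close>.\<close>

lemma smooth_piece_flat: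
  assumes "u < v" "open J" "{u..v} \<subseteq> J" "smooth_curve_on A J \<delta>" "\<And>s. s \<in> {u..v} \<Longrightarrow> \<delta> s = \<gamma> s"
  shows "speed \<gamma> integrable_on {u..v}" "flat_path (\<gamma> u) (\<gamma> v) (integral {u..v} (speed \<gamma>))"
proof -
  obtain \<phi> \<phi>' :: "real \<Rightarrow> real" where \<phi>:
    "smooth_on UNIV \<phi>" "\<And>s. (\<phi> has_real_derivative \<phi>' s) (at s)" "\<And>s. \<phi>' s \<ge> 0"
    "\<And>s. s \<le> 0 \<Longrightarrow> \<phi> s = 0" "\<And>s. s \<ge> 1 \<Longrightarrow> \<phi> s = 1" "\<And>s. 0 \<le> \<phi> s \<and> \<phi> s \<le> 1"
    by (rule smooth_step_exists) blast
  have cont: "continuous_on {u..v} (speed \<delta>)"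
    by (rule continuous_on_subset[OF speed_continuous[OF assms(2,4)] assms(3)])
  \<comment> \<open>At \<open>u\<close> and \<open>v\<close> the two-sided derivative of
    \<open>\<gamma>\<close> depends on its values outside the piece and may be arbitrary; two points
    do not affect the integral.\<close>
  have same: "speed \<gamma> s = speed \<delta> s" if "s \<in> {u..v} - {u, v}" for s
    by (rule speed_cong[of "{u<..<v}"]) (use that assms(5) in auto)
  have "(speed \<delta> has_integral integral {u..v} (speed \<delta>)) {u..v}"
    using integrable_continuous_real[OF cont] by (rule integrable_integral)
  then have int: "(speed \<gamma> has_integral integral {u..v} (speed \<delta>)) {u..v}"
    by (rule has_integral_spike_finite[of "{u, v}", rotated 2]) (use same in auto)
  then show "speed \<gamma> integrable_on {u..v}" by blast
  define \<psi> where "\<psi> s = (v - u) * \<phi> s + u" for s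
  have \<psi>_range: "\<psi> s \<in> {u..v}" for s
  proof -
    have "(v - u) * \<phi> s \<le> (v - u) * 1" "0 \<le> (v - u) * \<phi> s"
      using \<phi>(6)[of s] assms(1) by (intro mult_left_mono mult_nonneg_nonneg; simp)+
    then show ?thesis by (simp add: \<psi>_def)
  qed
  have \<psi>_der: "(\<psi> has_real_derivative (v - u) * \<phi>' s) (at s)" for s
    unfolding \<psi>_def by (auto intro!: derivative_eq_intros \<phi>(2))
  have sm\<psi>: "smooth_on UNIV \<psi>"
    unfolding \<psi>_def by (intro smooth_on_add smooth_on_mult smooth_on_const open_UNIV \<phi>(1))
  have "smooth_curve_on A UNIV (\<lambda>s. \<delta> (\<psi> s))"
    by (rule smooth_curve_on_compose[OF assms(4) sm\<psi> open_UNIV]) (use \<psi>_range assms(3) in auto)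
  moreover have "(speed (\<lambda>s. \<delta> (\<psi> s)) has_integral integral {u..v} (speed \<delta>)) {0..1}"
  proof -
    have "speed (\<lambda>s. \<delta> (\<psi> s)) = (\<lambda>s. ((v - u) * \<phi>' s) *\<^sub>R speed \<delta> (\<psi> s))"
    proof
      fix s
      have "\<psi> s \<in> J" using \<psi>_range assms(3) by blast
      from speed_compose[OF assms(2,4) this \<psi>_der]
      show "speed (\<lambda>s. \<delta> (\<psi> s)) s = ((v - u) * \<phi>' s) *\<^sub>R speed \<delta> (\<psi> s)"
        using assms(1) \<phi>(3)[of s] by simp
    qed
    moreover have "((\<lambda>s. ((v - u) * \<phi>' s) *\<^sub>R speed \<delta> (\<psi> s)) has_integral integral {\<psi> 0..\<psi> 1} (speed \<delta>)) {0..1}"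
    proof (rule has_integral_substitution[OF _ _ _ cont])
      show "\<psi> ` {0..1} \<subseteq> {u..v}" using \<psi>_range by auto
      show "\<psi> 0 \<le> \<psi> 1" using assms(1) by (simp add: \<psi>_def \<phi>(4,5))
    qed (auto intro: has_field_derivative_at_within \<psi>_der)
    moreover have "\<psi> 0 = u" "\<psi> 1 = v" by (simp_all add: \<psi>_def \<phi>(4,5))
    ultimately show ?thesis by simp
  qed
  ultimately have "flat_curve (\<lambda>s. \<delta> (\<psi> s)) (\<gamma> u) (\<gamma> v) (integral {u..v} (speed \<delta>))"
    using assms(1) assms(5)[of u] assms(5)[of v] by (simp add: flat_curve_def \<psi>_def \<phi>(4,5))
  then show "flat_path (\<gamma> u) (\<gamma> v) (integral {u..v} (speed \<gamma>))"
    unfolding flat_path_def integral_unique[OF int] by blast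
qed

lemma piecewise_smooth_flat_aux:
  assumes "finite F" "a < b"
    and "\<And>u v. a \<le> u \<and> u < v \<and> v \<le> b \<and> {u<..<v} \<inter> F = {} \<Longrightarrow>
         (\<exists>J \<delta>. open J \<and> {u..v} \<subseteq> J \<and> smooth_curve_on A J \<delta> \<and> (\<forall>s\<in>{u..v}. \<delta> s = \<gamma> s))"
  shows "speed \<gamma> integrable_on {a..b} \<and> flat_path (\<gamma> a) (\<gamma> b) (integral {a..b} (speed \<gamma>))"
  using assms
proof (induction F arbitrary: a b rule: finite_induct)
  case empty
  obtain J \<delta> where "open J" "{a..b} \<subseteq> J" "smooth_curve_on A J \<delta>" "\<forall>s\<in>{a..b}. \<delta> s = \<gamma> s"
    using empty.prems(2)[of a b] empty.prems(1) by blast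
  then show ?case using smooth_piece_flat[OF empty.prems(1)] by blast
next
  case (insert f F)
  show ?case
  proof (cases "a < f \<and> f < b")
    case True
    then have le: "a \<le> f" "f \<le> b" by auto
    have l: "speed \<gamma> integrable_on {a..f} \<and> flat_path (\<gamma> a) (\<gamma> f) (integral {a..f} (speed \<gamma>))"
      by (rule insert.IH) (use True in simp, rule insert.prems(2), use True in auto)
    have r: "speed \<gamma> integrable_on {f..b} \<and> flat_path (\<gamma> f) (\<gamma> b) (integral {f..b} (speed \<gamma>))"
      by (rule insert.IH) (use True in simp, rule insert.prems(2), use True in auto)
    have int: "speed \<gamma> integrable_on {a..b}"
      by (rule Henstock_Kurzweil_Integration.integrable_combine[OF le conjunct1[OF l] conjunct1[OF r]])
    show ?thesis
      using flat_path_trans[OF conjunct2[OF l] conjunct2[OF r]] int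
      unfolding Henstock_Kurzweil_Integration.integral_combine[OF le int] by blast
  next
    case False
    show ?thesis
      by (rule insert.IH[OF insert.prems(1)], rule insert.prems(2)) (use False in auto)
  qed
qed

lemma piecewise_smooth_flat:
  assumes "a < b" "piecewise_smooth_curve A a b \<gamma>"
  shows "flat_path (\<gamma> a) (\<gamma> b) (curve_length A h a b \<gamma>)"
proof -
  obtain F where "finite F"
    "\<And>u v. a \<le> u \<and> u < v \<and> v \<le> b \<and> {u<..<v} \<inter> F = {} \<Longrightarrow>
         (\<exists>J \<delta>. open J \<and> {u..v} \<subseteq> J \<and> smooth_curve_on A J \<delta> \<and> (\<forall>s\<in>{u..v}. \<delta> s = \<gamma> s))"
    using assms(2) unfolding piecewise_smooth_curve_def by blast
  then show ?thesis
    unfolding curve_length_speed using piecewise_smooth_flat_aux[OF _ assms(1)] by blast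
qed

lemma flat_curve_piecewise:
  assumes "flat_curve c x y l"
  shows "piecewise_smooth_curve A 0 1 c" "curve_length A h 0 1 c = l" "c 0 = x" "c 1 = y"
proof -
  have c: "smooth_curve_on A UNIV c" using assms by (simp add: flat_curve_def)
  have "continuous_on {0..1} c"
    using c by (auto simp: smooth_curve_on_def intro: continuous_on_subset)
  then show "piecewise_smooth_curve A 0 1 c"
    unfolding piecewise_smooth_curve_def
    by (intro conjI exI[of _ "{}"]) (use c in \<open>auto intro!: exI[of _ UNIV] exI[of _ c]\<close>)
  show "curve_length A h 0 1 c = l" "c 0 = x" "c 1 = y"
    using assms by (auto simp: flat_curve_def curve_length_speed)
qed

text \<open>Not only the infima but the two sets of lengths agree, so from here on corners never
  have to be considered.\<close>

lemma riemannian_dist_flat: "riemannian_dist A h x y = Inf {l. flat_path x y l}"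
proof -
  have "{curve_length A h a b \<gamma> | a b \<gamma>. a < b \<and> piecewise_smooth_curve A a b \<gamma> \<and> \<gamma> a = x \<and> \<gamma> b = y}
      = {l. flat_path x y l}"
  proof (intro equalityI subsetI)
    fix l assume "l \<in> {l. flat_path x y l}"
    then obtain c where "flat_curve c x y l" by (auto simp: flat_path_def)
    note flat_curve_piecewise[OF this]
    then show "l \<in> {curve_length A h a b \<gamma> | a b \<gamma>. a < b \<and> piecewise_smooth_curve A a b \<gamma> \<and> \<gamma> a = x \<and> \<gamma> b = y}"
      by (intro CollectI exI[of _ 0] exI[of _ 1] exI[of _ c]) auto
  qed (use piecewise_smooth_flat in blast)
  then show ?thesis by (simp add: riemannian_dist_def)
qed

lemma flat_path_nonneg: "flat_path x y l \<Longrightarrow> l \<ge> 0"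
  unfolding flat_path_def using flat_curve_nonneg by blast

lemma riemannian_dist_le: "flat_path x y l \<Longrightarrow> riemannian_dist A h x y \<le> l"
  unfolding riemannian_dist_flat
  by (rule cInf_lower) (auto intro!: bdd_belowI[of _ 0] flat_path_nonneg)

text \<open>The link between the manifold topology and the distance: nearby points are joined by a
  segment in a chart, traversed with a step function so as to rest at both ends. On a compact ball
  the metric coefficients are bounded, hence the length is at most a constant times the Euclidean
  one.\<close>

lemma short_flat_path:
  assumes "\<epsilon> > 0"
  obtains U where "open U" "p \<in> U" "\<And>y z. y \<in> U \<Longrightarrow> z \<in> U \<Longrightarrow> \<exists>l<\<epsilon>. flat_path y z l"
proof -
  obtain c where c: "c \<in> A" "p \<in> chart_dom c" by (rule chart_around)
  note cs = chart_simps[OF c(1)]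
  define G where "G i j x = h (chart_inv c x) (tvec_of A (chart_inv c x) c i) (tvec_of A (chart_inv c x) c j)" for i j x
  define S where "S x = (\<Sum>i\<in>Basis. \<Sum>j\<in>Basis. \<bar>G i j x\<bar>)" for x
  have "continuous_on (chart_img c) (G i j)" for i j
    unfolding G_def by (rule smooth_on_continuous[OF metric_smooth[OF c(1)]])
  then have contS: "continuous_on (chart_img c) S"
    unfolding S_def by (intro continuous_on_sum continuous_on_rabs)
  obtain r where r: "r > 0" "cball (chart_map c p) r \<subseteq> chart_img c"
    using cs(2) c(2) open_contains_cball by (metis imageI)
  have "compact (S ` cball (chart_map c p) r)"
    by (rule compact_continuous_image[OF continuous_on_subset[OF contS r(2)] compact_cball])
  then obtain K where K: "K > 0" "\<And>x. x \<in> cball (chart_map c p) r \<Longrightarrow> \<bar>S x\<bar> \<le> K"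
    using compact_imp_bounded bounded_pos[of "S ` cball (chart_map c p) r"] by auto
  \<comment> \<open>A segment in this ball is no longer than its diameter, and \<open>sqrt K\<close>
    times the diameter is at most \<epsilon>/2.\<close>
  define r' where "r' = min r (\<epsilon> / (4 * sqrt K))"
  have r': "r' > 0" "r' \<le> r" "sqrt K * (2 * r') < \<epsilon>"
  proof -
    show "r' > 0" "r' \<le> r" using r(1) K(1) assms by (auto simp: r'_def)
    have "sqrt K * (2 * r') \<le> sqrt K * (2 * (\<epsilon> / (4 * sqrt K)))"
      using K(1) by (intro mult_left_mono) (auto simp: r'_def)
    also have "\<dots> < \<epsilon>" using K(1) assms by (simp add: field_simps)
    finally show "sqrt K * (2 * r') < \<epsilon>" .
  qed
  define U where "U = chart_dom c \<inter> chart_map c -` ball (chart_map c p) r'"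
  have "open U" unfolding U_def by (rule continuous_open_preimage[OF cs(3,1) open_ball])
  moreover have "p \<in> U" using c r' by (simp add: U_def)
  moreover have "\<exists>l<\<epsilon>. flat_path y z l" if "y \<in> U" "z \<in> U" for y z
  proof -
    obtain \<phi> \<phi>' :: "real \<Rightarrow> real" where \<phi>:
      "smooth_on UNIV \<phi>" "\<And>s. (\<phi> has_real_derivative \<phi>' s) (at s)" "\<And>s. \<phi>' s \<ge> 0"
      "\<And>s. s \<le> 0 \<Longrightarrow> \<phi> s = 0" "\<And>s. s \<ge> 1 \<Longrightarrow> \<phi> s = 1" "\<And>s. 0 \<le> \<phi> s \<and> \<phi> s \<le> 1"
      by (rule smooth_step_exists) blast
    define w where "w = chart_map c z - chart_map c y"
    define f where "f s = \<phi> s *\<^sub>R w + chart_map c y" for s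
    have yz: "chart_map c y \<in> ball (chart_map c p) r'" "chart_map c z \<in> ball (chart_map c p) r'"
      "y \<in> chart_dom c" "z \<in> chart_dom c"
      using that by (auto simp: U_def)
    have f_eq: "f s = (1 - \<phi> s) *\<^sub>R chart_map c y + \<phi> s *\<^sub>R chart_map c z" for s
      by (simp add: f_def w_def algebra_simps)
    have f_ball: "f s \<in> ball (chart_map c p) r'" for s
      unfolding f_eq using convexD[OF convex_ball yz(1,2)] \<phi>(6)[of s] by simp
    then have f_cball: "f s \<in> cball (chart_map c p) r" for s
      using r'(2) by (metis ball_subset_cball subsetD subset_ball)
    then have f_img: "f s \<in> chart_img c" for s using r(2) by blast
    have smf: "smooth_on UNIV f"
      unfolding f_def by (intro smooth_on_add smooth_on_scaleR smooth_on_const open_UNIV \<phi>(1))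
    define k where "k s = chart_inv c (f s)" for s
    have smk: "smooth_curve_on A UNIV k"
      unfolding k_def by (rule smooth_curve_on_chart_inv[OF c(1) open_UNIV smf]) (use f_img in blast)
    have k_dom: "k s \<in> chart_dom c" for s unfolding k_def by (rule cs(7)[OF f_img])
    have k_map: "chart_map c \<circ> k = f" using cs(6)[OF f_img] by (auto simp: k_def)
    have f_der: "vector_derivative f (at s) = \<phi>' s *\<^sub>R w" for s
      unfolding f_def
      by (rule vector_derivative_at)
         (auto intro!: derivative_eq_intros \<phi>(2))
    have bound: "speed k s \<le> (sqrt K * norm w) * \<phi>' s" for s
    proof -
      have "velocity A k s = tvec_of A (k s) c (\<phi>' s *\<^sub>R w)"
        using velocity_eq_tvec_of[OF open_UNIV smk UNIV_I c(1) k_dom] by (simp add: k_map f_der)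
      also have "\<dots> = (\<lambda>d. \<phi>' s *\<^sub>R tvec_of A (k s) c w d)"
        using tvec_of_linear[OF c(1) k_dom, of s "\<phi>' s" w 0 0] by simp
      finally have "speed k s = \<phi>' s * sqrt (h (k s) (tvec_of A (k s) c w) (tvec_of A (k s) c w))"
        using \<phi>(3)[of s] by (simp add: speed_def metric_scale[OF tvec_of_tangent[OF c(1) k_dom]] real_sqrt_mult)
      \<comment> \<open>Each coordinate of \<open>w\<close> is bounded by its norm, so the quadratic
        form is at most the squared norm times the sum \<open>S\<close> of the absolute
        coefficients.\<close>
      also have "h (k s) (tvec_of A (k s) c w) (tvec_of A (k s) c w) \<le> K * (norm w)\<^sup>2"
      proof -
        have "h (k s) (tvec_of A (k s) c w) (tvec_of A (k s) c w)
            = (\<Sum>i\<in>Basis. \<Sum>j\<in>Basis. (w \<bullet> i) * (w \<bullet> j) * G i j (f s))"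
          unfolding metric_expand[OF c(1) k_dom] by (simp add: G_def k_def sum_distrib_left mult.assoc)
        also have "\<dots> \<le> (\<Sum>i\<in>Basis. \<Sum>j\<in>Basis. (norm w * norm w) * \<bar>G i j (f s)\<bar>)"
        proof (intro sum_mono)
          fix i j :: 'e assume "i \<in> Basis" "j \<in> Basis"
          have "(w \<bullet> i) * (w \<bullet> j) * G i j (f s) \<le> \<bar>w \<bullet> i\<bar> * \<bar>w \<bullet> j\<bar> * \<bar>G i j (f s)\<bar>"
            by (metis abs_ge_self abs_mult)
          also have "\<dots> \<le> (norm w * norm w) * \<bar>G i j (f s)\<bar>"
            using \<open>i \<in> Basis\<close> \<open>j \<in> Basis\<close> by (intro mult_right_mono mult_mono Basis_le_norm) auto
          finally show "(w \<bullet> i) * (w \<bullet> j) * G i j (f s) \<le> (norm w * norm w) * \<bar>G i j (f s)\<bar>" .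
        qed
        also have "\<dots> = (norm w)\<^sup>2 * S (f s)"
          by (simp add: S_def sum_distrib_left power2_eq_square)
        also have "\<dots> \<le> (norm w)\<^sup>2 * K"
          using K(2)[OF f_cball, of s] by (intro mult_left_mono) auto
        finally show ?thesis by (simp add: mult.commute)
      qed
      then have "\<phi>' s * sqrt (h (k s) (tvec_of A (k s) c w) (tvec_of A (k s) c w)) \<le> \<phi>' s * sqrt (K * (norm w)\<^sup>2)"
        using \<phi>(3)[of s] by (intro mult_left_mono) auto
      finally show ?thesis by (simp add: real_sqrt_mult mult_ac)
    qed
    have int: "(speed k has_integral integral {0..1} (speed k)) {0..1}"
      using continuous_on_subset[OF speed_continuous[OF open_UNIV smk], of "{0..1}"]
      by (intro integrable_integral integrable_continuous_real) simp
    have "flat_curve k y z (integral {0..1} (speed k))"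
      using int smk \<phi>(4,5) cs(5)[OF yz(3)] cs(5)[OF yz(4)]
      by (auto simp: flat_curve_def k_def f_def w_def)
    moreover have "integral {0..1} (speed k) < \<epsilon>"
    proof -
      have "(\<phi>' has_integral (\<phi> 1 - \<phi> 0)) {0..1}"
        by (rule fundamental_theorem_of_calculus)
           (use \<phi>(2) in \<open>auto simp: has_real_derivative_iff_has_vector_derivative[symmetric]
               intro: has_field_derivative_at_within\<close>)
      then have "((\<lambda>s. (sqrt K * norm w) * \<phi>' s) has_integral (sqrt K * norm w) * (\<phi> 1 - \<phi> 0)) {0..1}"
        by (rule has_integral_mult_right)
      then have "integral {0..1} (speed k) \<le> sqrt K * norm w"
        using has_integral_le[OF int] bound \<phi>(4)[of 0] \<phi>(5)[of 1] by simp
      also have "norm w \<le> 2 * r'"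
        using yz(1,2) dist_triangle[of "chart_map c z" "chart_map c y" "chart_map c p"]
        by (simp add: w_def dist_norm[symmetric] dist_commute)
      then have "sqrt K * norm w \<le> sqrt K * (2 * r')" using K(1) by (intro mult_left_mono) auto
      also note r'(3)
      finally show ?thesis .
    qed
    ultimately show ?thesis unfolding flat_path_def by blast
  qed
  ultimately show ?thesis by (rule that)
qed

text \<open>The points reachable from \<open>x\<close> form an open set with open complement. This
  also keeps the infimum that defines the distance from being taken over the empty set.\<close>

lemma flat_path_exists:
  assumes "connected (UNIV :: 's set)"
  shows "\<exists>l. flat_path x y l"
proof -
  define R where "R = {y. \<exists>l. flat_path x y l}"
  have "open R"
  proof (subst open_subopen, intro ballI)
    fix y assume "y \<in> R"
    obtain U where U: "open U" "y \<in> U" "\<And>a b. a \<in> U \<Longrightarrow> b \<in> U \<Longrightarrow> \<exists>l<1. flat_path a b l"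
      using short_flat_path[OF zero_less_one, of y] by blast
    have "U \<subseteq> R"
    proof
      fix z assume "z \<in> U"
      then show "z \<in> R"
        using \<open>y \<in> R\<close> U(3)[OF U(2)] flat_path_trans[of x y _ z] unfolding R_def by blast
    qed
    then show "\<exists>T. open T \<and> y \<in> T \<and> T \<subseteq> R" using U(1,2) by blast
  qed
  moreover have "open (- R)"
  proof (subst open_subopen, intro ballI)
    fix y assume "y \<in> - R"
    obtain U where U: "open U" "y \<in> U" "\<And>a b. a \<in> U \<Longrightarrow> b \<in> U \<Longrightarrow> \<exists>l<1. flat_path a b l"
      using short_flat_path[OF zero_less_one, of y] by blast
    have "U \<subseteq> - R"
    proof
      fix z assume "z \<in> U"
      then show "z \<in> - R"
        using \<open>y \<in> - R\<close> U(3)[OF _ U(2)] flat_path_trans[of x z _ y] unfolding R_def by blast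
    qed
    then show "\<exists>T. open T \<and> y \<in> T \<and> T \<subseteq> - R" using U(1,2) by blast
  qed
  moreover have "x \<in> R" unfolding R_def flat_path_def using flat_curve_const by blast
  ultimately have "- R = {}"
    using connectedD[OF assms, of R "- R"] by auto
  then show ?thesis by (auto simp: R_def)
qed

lemma riemannian_dist_less:
  assumes "connected (UNIV :: 's set)" "riemannian_dist A h x y < \<epsilon>"
  shows "\<exists>l<\<epsilon>. flat_path x y l"
  using assms(2) flat_path_exists[OF assms(1), of x y] cInf_lessD[of "{l. flat_path x y l}" \<epsilon>]
  unfolding riemannian_dist_flat by auto

lemma riemannian_dist_nonneg:
  assumes "connected (UNIV :: 's set)"
  shows "riemannian_dist A h x y \<ge> 0"
  using riemannian_dist_less[OF assms, of x y 0] flat_path_nonneg by fastforce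

text \<open>The strict form suits an infimum: a strict upper bound is already undercut by the length
  of an actual curve, and these curves are concatenated.\<close>

lemma riemannian_dist_triangle:
  assumes "connected (UNIV :: 's set)" "riemannian_dist A h x y < a" "riemannian_dist A h y z < b"
  shows "riemannian_dist A h x z < a + b"
proof -
  obtain l l' where "l < a" "flat_path x y l" "l' < b" "flat_path y z l'"
    using riemannian_dist_less[OF assms(1)] assms(2,3) by blast
  then show ?thesis using riemannian_dist_le[OF flat_path_trans, of x y l z l'] by simp
qed

end

section \<open>Curves escaping from an incomplete manifold\<close>

context riemannian_manifold begin

text \<open>The summand \<open>(exp (- s))\<^sup>2\<close> keeps the root smooth where the curve stands still; it is integrable
  towards \<open>\<infinity>\<close> but not towards \<open>-\<infinity>\<close>.\<close>

definition time_rate :: "(real \<Rightarrow> 's) \<Rightarrow> real \<Rightarrow> real" where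
  "time_rate c s = sqrt (h (c s) (velocity A c s) (velocity A c s) + (exp (- s))\<^sup>2)"

text \<open>This lower bound drives the primitive of the rate to minus infinity in the past; the
  upper bound in the next lemma has a finite integral over the positive half line when the curve has
  finite length there.\<close>

lemma time_rate_ge:
  assumes "smooth_curve_on A UNIV c"
  shows "time_rate c s \<ge> exp (- s)"
  using metric_nonneg[OF velocity_tangent[OF open_UNIV assms UNIV_I]]
  by (auto simp: time_rate_def intro!: real_le_rsqrt)

lemma time_rate_le:
  assumes "smooth_curve_on A UNIV c"
  shows "time_rate c s \<le> speed c s + exp (- s)"
  using sqrt_add_le_add_sqrt[OF metric_nonneg[OF velocity_tangent[OF open_UNIV assms UNIV_I]], of "(exp (- s))\<^sup>2" s]
  by (simp add: time_rate_def speed_def)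

lemma time_rate_smooth:
  assumes "smooth_curve_on A UNIV c"
  shows "smooth_on UNIV (time_rate c)"
  unfolding time_rate_def[abs_def] power2_eq_square
proof (rule smooth_on_sqrt[OF open_UNIV])
  show "smooth_on UNIV (\<lambda>s. h (c s) (velocity A c s) (velocity A c s) + exp (- s) * exp (- s))"
    by (intro smooth_on_add smooth_on_mult open_UNIV smooth_on_exp_minus metric_along_smooth assms)
  show "h (c s) (velocity A c s) (velocity A c s) + exp (- s) * exp (- s) > 0" for s
    using metric_nonneg[OF velocity_tangent[OF open_UNIV assms UNIV_I], of s] by (simp add: add_nonneg_pos)
qed

text \<open>Successive members of a subsequence are joined by flat curves of geometrically
  decreasing length. If the concatenation had an endpoint, members of the subsequence would enter
  every neighbourhood of it, hence come arbitrarily close in distance, and the whole Cauchy sequence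
  would converge to it.\<close>

lemma incomplete_imp_escaping_curve:
  assumes "connected (UNIV :: 's set)" "\<not> riemannian_complete A h"
  obtains c l where "smooth_curve_on A UNIV c" "\<nexists>p. upper_endpoint UNIV c p"
    "\<And>n. (speed c has_integral l n) {real n..real (Suc n)}" "\<And>n. l n \<le> (1/2) ^ n"
proof -
  let ?d = "riemannian_dist A h"
  obtain x where cauchy: "\<And>\<epsilon>. \<epsilon> > 0 \<Longrightarrow> \<exists>N. \<forall>m\<ge>N. \<forall>n\<ge>N. ?d (x m) (x n) < \<epsilon>"
    and nolim: "\<And>l. \<not> (\<lambda>n. ?d (x n) l) \<longlonglongrightarrow> 0"
    using assms(2) unfolding riemannian_complete_def by blast
  have "\<forall>k. \<exists>N. \<forall>m\<ge>N. \<forall>n\<ge>N. ?d (x m) (x n) < (1/2) ^ k"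
    using cauchy by simp
  then obtain N where N: "\<And>k m n. m \<ge> N k \<Longrightarrow> n \<ge> N k \<Longrightarrow> ?d (x m) (x n) < (1/2) ^ k"
    by metis
  \<comment> \<open>Summing gives bounds by \<open>N k\<close> for both \<open>r k\<close> and
    \<open>r (Suc k)\<close> without monotonicity of \<open>N\<close>; the summand \<open>k\<close>
    makes the indices unbounded.\<close>
  define r where "r k = (\<Sum>i\<le>k. N i) + k" for k
  have Nle: "N k \<le> (\<Sum>i\<le>k. N i)" for k
    by (cases k) auto
  have r: "r k \<ge> k" "r k \<ge> N k" "r (Suc k) \<ge> N k" for k
    using Nle[of k] by (simp_all add: r_def)
  have "\<forall>k. \<exists>l<(1/2) ^ k. flat_path (x (r k)) (x (r (Suc k))) l"
    using riemannian_dist_less[OF assms(1)] N r by blast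
  then obtain l where l: "\<And>k. l k < (1/2) ^ k" "\<And>k. flat_path (x (r k)) (x (r (Suc k))) (l k)"
    by metis
  then obtain c where "\<And>k. flat_curve (c k) (x (r k)) (x (r (Suc k))) (l k)"
    unfolding flat_path_def by metis
  note C = concat_curve[of c "\<lambda>k. x (r k)" l, OF this]
  have "\<not> upper_endpoint UNIV (concat_curve c) p" for p
  proof
    assume p: "upper_endpoint UNIV (concat_curve c) p"
    have "(\<lambda>n. ?d (x n) p) \<longlonglongrightarrow> 0"
    proof (rule LIMSEQ_I)
      fix \<epsilon> :: real assume "\<epsilon> > 0"
      then have e: "\<epsilon> / 2 > 0" by simp
      obtain U where U: "open U" "p \<in> U" "\<And>y z. y \<in> U \<Longrightarrow> z \<in> U \<Longrightarrow> \<exists>l<\<epsilon> / 2. flat_path y z l"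
        using short_flat_path[OF e, of p] by blast
      obtain s0 where s0: "\<And>s. s0 \<le> s \<Longrightarrow> concat_curve c s \<in> U"
        using p U(1,2) unfolding upper_endpoint_def by blast
      obtain n0 where n0: "\<And>m n. m \<ge> n0 \<Longrightarrow> n \<ge> n0 \<Longrightarrow> ?d (x m) (x n) < \<epsilon> / 2"
        using cauchy[OF e] by blast
      \<comment> \<open>Late enough both for the curve to lie in \<open>U\<close> at parameter
        \<open>K\<close> and for \<open>x (r K)\<close> to be within \<epsilon>/2 of the tail of the
        sequence.\<close>
      define K where "K = max n0 (nat \<lceil>s0\<rceil>)"
      have "s0 \<le> real K" by (simp add: K_def) linarith
      then have "x (r K) \<in> U" using s0[of "real K"] C(2)[of K] by simp
      then obtain l where "l < \<epsilon> / 2" "flat_path (x (r K)) p l" using U(2,3) by blast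
      then have K: "?d (x (r K)) p < \<epsilon> / 2" using riemannian_dist_le by fastforce
      have "norm (?d (x n) p - 0) < \<epsilon>" if "n \<ge> n0" for n
      proof -
        have "?d (x n) (x (r K)) < \<epsilon> / 2"
          using n0[OF that, of "r K"] r(1)[of K] by (simp add: K_def)
        from riemannian_dist_triangle[OF assms(1) this K] show ?thesis
          using riemannian_dist_nonneg[OF assms(1), of "x n" p] by simp
      qed
      then show "\<exists>n0. \<forall>n\<ge>n0. norm (?d (x n) p - 0) < \<epsilon>" by blast
    qed
    then show False using nolim by blast
  qed
  then show ?thesis using that[OF C(1) _ C(3)] l(1) less_imp_le by blast
qed

lemma incomplete_imp_time_function:
  assumes "connected (UNIV :: 's set)" "\<not> riemannian_complete A h"
  obtains c T B where "smooth_curve_on A UNIV c" "\<nexists>p. upper_endpoint UNIV c p"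
    "smooth_on UNIV T" "\<And>s. (T has_real_derivative time_rate c s) (at s)"
    "\<And>s. T s \<le> B" "\<And>s. s \<le> 0 \<Longrightarrow> T s \<le> T 0 + s"
proof -
  obtain c l where c: "smooth_curve_on A UNIV c" "\<nexists>p. upper_endpoint UNIV c p"
    and l: "\<And>n. (speed c has_integral l n) {real n..real (Suc n)}" "\<And>n. l n \<le> (1/2) ^ n"
    by (rule incomplete_imp_escaping_curve[OF assms]) blast
  obtain T where T: "\<And>s. (T has_real_derivative time_rate c s) (at s)"
    using continuous_has_antiderivative[OF smooth_on_continuous[OF time_rate_smooth[OF c(1)]]] by blast
  have E: "((\<lambda>s. - exp (- s)) has_real_derivative exp (- s)) (at s)" for s :: real
    by (auto intro!: derivative_eq_intros)
  have step: "T (real (Suc n)) - T (real n) \<le> l n + (exp (- real n) - exp (- real (Suc n)))" for n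
  proof -
    have i1: "(time_rate c has_integral T (real (Suc n)) - T (real n)) {real n..real (Suc n)}"
      by (rule fundamental_theorem_of_calculus)
         (auto simp: has_real_derivative_iff_has_vector_derivative[symmetric] intro: has_field_derivative_at_within T)
    have i2: "((\<lambda>s. exp (- s)) has_integral - exp (- real (Suc n)) - - exp (- real n)) {real n..real (Suc n)}"
      by (rule fundamental_theorem_of_calculus)
         (auto simp: has_real_derivative_iff_has_vector_derivative[symmetric] intro: has_field_derivative_at_within E)
    show ?thesis
      using has_integral_le[OF i1 has_integral_add[OF l(1)[of n] i2] time_rate_le[OF c(1)]] by simp
  qed
  \<comment> \<open>The first bracket is the partial sum of the bounds on \<open>l\<close>, the
    second is the integral of exp(-s) from 0 to \<open>n\<close>; keeping both exact lets the
    induction go through.\<close>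
  have bound: "T (real n) \<le> T 0 + (2 - 2 * (1/2) ^ n) + (1 - exp (- real n))" for n
  proof (induction n)
    case (Suc n)
    then show ?case using step[of n] l(2)[of n] by simp
  qed simp
  have mono: "T x \<le> T y" if "x \<le> y" for x y
  proof (rule DERIV_nonneg_imp_nondecreasing[OF that])
    show "\<exists>y. (T has_real_derivative y) (at t) \<and> 0 \<le> y" for t
      using T[of t] order_trans[OF exp_ge_zero time_rate_ge[OF c(1), of t]] by blast
  qed
  have "T s \<le> T 0 + 3" for s
  proof -
    have "T s \<le> T (real (nat \<lceil>s\<rceil>))" by (rule mono) linarith
    also have "\<dots> \<le> T 0 + 3"
      using bound[of "nat \<lceil>s\<rceil>"] exp_ge_zero[of "- real (nat \<lceil>s\<rceil>)"]
        zero_le_power[of "1/2 :: real" "nat \<lceil>s\<rceil>"] by linarith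
    finally show ?thesis .
  qed
  moreover have "T s \<le> T 0 + s" if "s \<le> 0" for s
  proof -
    \<comment> \<open>The function T(s) + exp(-s) is nondecreasing by the lower bound on the rate.
      With exp(-s) at least 1 - s this gives a linear bound on T.\<close>
    have "T s - - exp (- s) \<le> T 0 - - exp (- 0)"
    proof (rule DERIV_nonneg_imp_nondecreasing[OF that])
      show "\<exists>y. ((\<lambda>s. T s - - exp (- s)) has_real_derivative y) (at t) \<and> 0 \<le> y" for t
        using DERIV_diff[OF T E, of t] time_rate_ge[OF c(1), of t] by (intro exI conjI) auto
    qed
    then show ?thesis using exp_ge_add_one_self[of "- s"] by simp
  qed
  moreover have "smooth_on UNIV T"
    by (rule smooth_on_antiderivative[OF open_UNIV time_rate_smooth[OF c(1)] T])
  ultimately show ?thesis using that[OF c _ T] by blast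
qed

end

section \<open>Curves in the spacetime\<close>

context manifold_atlas begin

definition prod_chart :: "('s, 'e) chart \<Rightarrow> (real \<times> 's, real \<times> 'e) chart" where
  "prod_chart d = (UNIV \<times> chart_dom d, map_prod id (chart_map d))"

text \<open>The time line carries the identity chart alone, so spacetime charts are indexed by
  charts of the base.\<close>

lemma spacetime_atlas_eq: "spacetime_atlas A = prod_chart ` A"
proof (intro equalityI subsetI)
  fix e assume "e \<in> prod_chart ` A"
  then obtain d where "d \<in> A" "e = prod_chart d" by blast
  then show "e \<in> spacetime_atlas A"
    unfolding prod_atlas_def real_atlas_def
    by (intro CollectI exI[of _ "(UNIV, id)"] exI[of _ d]) (simp add: prod_chart_def)
qed (auto simp: prod_atlas_def real_atlas_def prod_chart_def image_iff intro!: bexI)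

lemma prod_chart_simps [simp]:
  "chart_dom (prod_chart d) = UNIV \<times> chart_dom d"
  "chart_map (prod_chart d) = map_prod id (chart_map d)"
  by (simp_all add: prod_chart_def)

lemma prod_chart_inv:
  assumes "d \<in> A" "y \<in> chart_img d"
  shows "chart_inv (prod_chart d) (t, y) = (t, chart_inv d y)"
proof -
  have "inj_on (chart_map d) (chart_dom d)"
    by (rule inj_on_inverseI[of _ "chart_inv d"]) (rule chart_simps(5)[OF assms(1)])
  then have "inj_on (map_prod id (chart_map d)) (UNIV \<times> chart_dom d)"
    by (auto simp: inj_on_def)
  then have "inv_into (UNIV \<times> chart_dom d) (map_prod id (chart_map d)) (t, y) = (t, chart_inv d y)"
    by (rule inv_into_f_eq) (use chart_simps(6,7)[OF assms] in auto)
  then show ?thesis by (simp add: chart_inv_def[of "prod_chart d"])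
qed

lemma graph_curve_smooth:
  assumes "smooth_on UNIV \<tau>" "smooth_curve_on A UNIV c"
  shows "smooth_curve_on (spacetime_atlas A) UNIV (\<lambda>s. (\<tau> s, c s))"
  unfolding smooth_curve_on_def spacetime_atlas_eq
proof (intro conjI ballI)
  have cont: "continuous_on UNIV c" using assms(2) by (simp add: smooth_curve_on_def)
  then show "continuous_on UNIV (\<lambda>s. (\<tau> s, c s))"
    by (intro continuous_on_Pair smooth_on_continuous[OF assms(1)])
  fix e assume "e \<in> prod_chart ` A"
  then obtain d where d: "d \<in> A" "e = prod_chart d" by blast
  have eq: "UNIV \<inter> (\<lambda>s. (\<tau> s, c s)) -` chart_dom e = UNIV \<inter> c -` chart_dom d"
    using d by auto
  have op: "open (UNIV \<inter> c -` chart_dom d)"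
    by (rule curve_preimage_open[OF open_UNIV cont d(1)])
  have "smooth_on (UNIV \<inter> c -` chart_dom d) (\<lambda>s. chart_map d (c s))"
    using assms(2) d(1) unfolding smooth_curve_on_def comp_def by blast
  from smooth_on_Pair[OF op smooth_on_subset[OF assms(1) subset_UNIV] this]
  show "smooth_on (UNIV \<inter> (\<lambda>s. (\<tau> s, c s)) -` chart_dom e) (chart_map e \<circ> (\<lambda>s. (\<tau> s, c s)))"
    unfolding eq by (simp add: d(2) comp_def)
qed

section \<open>The stationary metric on velocities of graph curves\<close>

lemma graph_curve_velocity:
  assumes "smooth_curve_on A UNIV c" "(\<tau> has_real_derivative \<tau>') (at s)" "d \<in> A" "c s \<in> chart_dom d"
  shows "velocity (spacetime_atlas A) (\<lambda>s. (\<tau> s, c s)) s (prod_chart d) = (\<tau>', velocity A c s d)"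
proof -
  have "((\<lambda>s. (\<tau> s, (chart_map d \<circ> c) s)) has_vector_derivative (\<tau>', velocity A c s d)) (at s)"
    using assms(2) curve_has_vector_derivative[OF assms(1) UNIV_I assms(3,4)]
    by (intro has_vector_derivative_Pair) (simp_all only: has_real_derivative_iff_has_vector_derivative)
  from vector_derivative_at[OF this] show ?thesis
    using assms(3,4) by (simp add: velocity_def spacetime_atlas_eq comp_def)
qed

text \<open>Since \<open>diff_fun\<close> computes in a chart picked by \<open>SOME\<close>, the
  value has to be established in every product chart around the point.\<close>

lemma graph_curve_diff_fun:
  assumes "smooth_curve_on A UNIV c" "(\<tau> has_real_derivative \<tau>') (at s)"
    and "\<And>d. d \<in> A \<Longrightarrow> c s \<in> chart_dom d \<Longrightarrow>
      \<exists>D. ((\<lambda>(t, y). f (t, chart_inv d y)) has_derivative D) (at (\<tau> s, chart_map d (c s))) \<and>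
        D (\<tau>', velocity A c s d) = r"
  shows "diff_fun (spacetime_atlas A) f (\<tau> s, c s) (velocity (spacetime_atlas A) (\<lambda>s. (\<tau> s, c s)) s) = r"
proof -
  define e where "e = (SOME e. e \<in> spacetime_atlas A \<and> (\<tau> s, c s) \<in> chart_dom e)"
  obtain d0 where "d0 \<in> A" "c s \<in> chart_dom d0" by (rule chart_around)
  then have "prod_chart d0 \<in> spacetime_atlas A \<and> (\<tau> s, c s) \<in> chart_dom (prod_chart d0)"
    by (simp add: spacetime_atlas_eq)
  then have "e \<in> spacetime_atlas A \<and> (\<tau> s, c s) \<in> chart_dom e"
    unfolding e_def by (rule someI)
  then obtain d where d: "e = prod_chart d" "d \<in> A" "c s \<in> chart_dom d"
    by (auto simp: spacetime_atlas_eq)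
  obtain D where D: "((\<lambda>(t, y). f (t, chart_inv d y)) has_derivative D) (at (\<tau> s, chart_map d (c s)))"
      "D (\<tau>', velocity A c s d) = r"
    using assms(3)[OF d(2,3)] by blast
  have "open (UNIV \<times> chart_img d :: (real \<times> 'e) set)"
    by (intro open_Times open_UNIV chart_simps(2)[OF d(2)])
  from D(1) this have "((f \<circ> chart_inv e) has_derivative D) (at (\<tau> s, chart_map d (c s)))"
    by (rule has_derivative_transform_within_open)
       (use d(3) prod_chart_inv[OF d(2)] in \<open>auto simp: d(1)\<close>)
  from frechet_derivative_at[OF this]
  have "frechet_derivative (f \<circ> chart_inv e) (at (chart_map e (\<tau> s, c s))) = D"
    by (simp add: d(1))
  then show ?thesis
    using D(2) graph_curve_velocity[OF assms(1,2) d(2,3)]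
    by (simp add: diff_fun_def e_def[symmetric] Let_def d(1))
qed

lemma graph_curve_dt:
  assumes "smooth_curve_on A UNIV c" "(\<tau> has_real_derivative \<tau>') (at s)"
  shows "diff_fun (spacetime_atlas A) fst (\<tau> s, c s) (velocity (spacetime_atlas A) (\<lambda>s. (\<tau> s, c s)) s) = \<tau>'"
proof (rule graph_curve_diff_fun[OF assms])
  fix d :: "('s, 'e) chart"
  have "((\<lambda>(t, y). fst (t, chart_inv d y)) has_derivative fst) (at (\<tau> s, chart_map d (c s)))"
    using has_derivative_fst[OF has_derivative_ident] by (simp add: case_prod_beta')
  then show "\<exists>D. ((\<lambda>(t, y). fst (t, chart_inv d y)) has_derivative D) (at (\<tau> s, chart_map d (c s))) \<and>
      D (\<tau>', velocity A c s d) = \<tau>'"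
    by (intro exI[of _ fst]) simp
qed

lemma graph_curve_pushforward:
  assumes "smooth_curve_on A UNIV c" "(\<tau> has_real_derivative \<tau>') (at s)"
  shows "pushforward (spacetime_atlas A) A snd (\<tau> s, c s) (velocity (spacetime_atlas A) (\<lambda>s. (\<tau> s, c s)) s)
    = velocity A c s"
proof
  fix e
  show "pushforward (spacetime_atlas A) A snd (\<tau> s, c s) (velocity (spacetime_atlas A) (\<lambda>s. (\<tau> s, c s)) s) e
    = velocity A c s e"
  proof (cases "e \<in> A \<and> c s \<in> chart_dom e")
    case True
    have "diff_fun (spacetime_atlas A) (chart_map e \<circ> snd) (\<tau> s, c s)
        (velocity (spacetime_atlas A) (\<lambda>s. (\<tau> s, c s)) s) = velocity A c s e"
    proof (rule graph_curve_diff_fun[OF assms])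
      fix d assume d: "d \<in> A" "c s \<in> chart_dom d"
      let ?D = "frechet_derivative (chart_map e \<circ> chart_inv d) (at (chart_map d (c s)))"
      have "((chart_map e \<circ> chart_inv d) has_derivative ?D) (at (snd (\<tau> s, chart_map d (c s))))"
        using transition_has_derivative[of d e "c s"] d True by simp
      from has_derivative_compose[OF has_derivative_snd[OF has_derivative_ident] this]
      have "((\<lambda>(t, y). (chart_map e \<circ> snd) (t, chart_inv d y)) has_derivative (\<lambda>v. ?D (snd v)))
          (at (\<tau> s, chart_map d (c s)))"
        by (simp add: case_prod_beta' comp_def)
      moreover have "?D (velocity A c s d) = velocity A c s e"
        using tangent_eq_tvec_of[OF d velocity_tangent[OF open_UNIV assms(1) UNIV_I], THEN fun_cong, of e] True
        by (simp add: tvec_of_def)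
      ultimately show "\<exists>D. ((\<lambda>(t, y). (chart_map e \<circ> snd) (t, chart_inv d y)) has_derivative D)
          (at (\<tau> s, chart_map d (c s))) \<and> D (\<tau>', velocity A c s d) = velocity A c s e"
        by (intro exI[of _ "\<lambda>v. ?D (snd v)"]) simp
    qed
    then show ?thesis using True by (simp add: pushforward_def)
  next
    case False
    then show ?thesis by (auto simp: pushforward_def velocity_def)
  qed
qed

lemma stationary_metric_graph_curve:
  assumes "smooth_curve_on A UNIV c" "(\<tau> has_real_derivative \<tau>') (at s)"
  defines "X \<equiv> velocity (spacetime_atlas A) (\<lambda>s. (\<tau> s, c s)) s" and "v \<equiv> velocity A c s"
  shows "stationary_metric A \<beta> \<omega> g\<^sub>0 (\<tau> s, c s) X X
    = - \<beta> (c s) * \<tau>'\<^sup>2 + 2 * \<omega> (c s) v * \<tau>' + g\<^sub>0 (c s) v v"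
  using graph_curve_dt[OF assms(1,2)] graph_curve_pushforward[OF assms(1,2)]
  by (simp add: stationary_metric_def Let_def tensor_prod_def pullback1_def pullback2_def X_def v_def
      power2_eq_square)

end

lemma riemannian_metric_fermat:
  assumes "smooth_atlas A" "riemannian_metric A g\<^sub>0" "smooth_form1 A \<omega>"
    and "smooth_function A \<beta>" "\<And>x. \<beta> x > 0"
  shows "riemannian_metric A (\<lambda>x X Y. 1 / \<beta> x * g\<^sub>0 x X Y + 1 / (\<beta> x)\<^sup>2 * tensor_prod \<omega> \<omega> x X Y)"
    (is "riemannian_metric A ?h")
proof -
  interpret G: riemannian_manifold A g\<^sub>0
    by unfold_locales (use assms in auto)
  have \<omega>: "linear_form_at A p (\<omega> p)" for p
    using assms(3) by (simp add: smooth_form1_def)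
  show ?thesis
    unfolding riemannian_metric_def
  proof (intro conjI allI ballI impI)
    fix p X assume X: "X \<in> tangent_space A p"
    show "linear_form_at A p (?h p X)"
      unfolding linear_form_at_def
    proof (intro ballI allI)
      fix Y Z and a b :: real assume YZ: "Y \<in> tangent_space A p" "Z \<in> tangent_space A p"
      have "g\<^sub>0 p X (\<lambda>c. a *\<^sub>R Y c + b *\<^sub>R Z c) = a * g\<^sub>0 p X Y + b * g\<^sub>0 p X Z"
        "\<omega> p (\<lambda>c. a *\<^sub>R Y c + b *\<^sub>R Z c) = a * \<omega> p Y + b * \<omega> p Z"
        using YZ G.metric_linear[OF X] \<omega>[of p] unfolding linear_form_at_def by blast+
      then show "?h p X (\<lambda>c. a *\<^sub>R Y c + b *\<^sub>R Z c) = a * ?h p X Y + b * ?h p X Z"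
        by (simp add: tensor_prod_def algebra_simps add_divide_distrib)
    qed
    show "?h p X Y = ?h p Y X" if "Y \<in> tangent_space A p" for Y
      using G.metric_sym[OF X that] by (simp add: tensor_prod_def mult.commute)
    show "?h p X X > 0" if "X \<noteq> (\<lambda>_. 0)"
      using G.metric_pos[OF X that] assms(5)[of p]
      by (simp add: tensor_prod_def add_pos_nonneg)
  next
    fix c v w assume c: "c \<in> A"
    let ?V = "\<lambda>v x. tvec_of A (chart_inv c x) c v"
    note op = G.chart_simps(2)[OF c]
    have b: "smooth_on (chart_img c) (\<lambda>x. inverse (\<beta> (chart_inv c x)))"
      using assms(4) c unfolding smooth_function_def comp_def
      by (intro smooth_on_inverse op) (auto simp: assms(5) less_imp_neq[OF assms(5), symmetric])
    have w: "smooth_on (chart_img c) (\<lambda>x. \<omega> (chart_inv c x) (?V v x))" for v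
      using assms(3) c unfolding smooth_form1_def by blast
    have "smooth_on (chart_img c) (\<lambda>x. inverse (\<beta> (chart_inv c x)) * g\<^sub>0 (chart_inv c x) (?V v x) (?V w x)
       + inverse (\<beta> (chart_inv c x)) * inverse (\<beta> (chart_inv c x)) *
         (\<omega> (chart_inv c x) (?V v x) * \<omega> (chart_inv c x) (?V w x)))"
      by (intro smooth_on_add smooth_on_mult op b w G.metric_smooth c)
    then show "smooth_on (chart_img c) (\<lambda>x. ?h (chart_inv c x) (?V v x) (?V w x))"
      by (simp add: tensor_prod_def power2_eq_square divide_inverse mult.assoc)
  qed
qed

text \<open>Divided by \<open>b\<close>, the claim is \<open>g/b + (w/b)\<^sup>2 < \<rho>\<^sup>2 \<le> (k \<rho> - w/b)\<^sup>2\<close>.\<close>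

lemma timelike_estimate:
  fixes b w g \<rho> k :: real
  assumes "b > 0" "g \<ge> 0" "\<rho> > 0" "1 / b * g + 1 / b\<^sup>2 * (w * w) < \<rho>\<^sup>2" "\<bar>k\<bar> \<ge> 2"
  shows "- b * (k * \<rho>)\<^sup>2 + 2 * w * (k * \<rho>) + g < 0"
proof -
  define u where "u = w / b"
  have 1: "g / b + u\<^sup>2 < \<rho>\<^sup>2" using assms(4) by (simp add: u_def power2_eq_square)
  moreover have "g / b \<ge> 0" using assms(1,2) by simp
  ultimately have "u\<^sup>2 < \<rho>\<^sup>2" by linarith
  then have "\<bar>u\<bar> < \<rho>"
    using assms(3) power2_less_imp_less[of "\<bar>u\<bar>" \<rho>] by simp
  moreover have "\<bar>k * \<rho>\<bar> \<ge> 2 * \<rho>" using assms(3,5) by (simp add: abs_mult)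
  ultimately have "\<bar>k * \<rho> - u\<bar> \<ge> \<rho>" by linarith
  then have "\<rho>\<^sup>2 \<le> (k * \<rho> - u)\<^sup>2" using assms(3) by (metis abs_le_square_iff abs_of_pos)
  with 1 have "- (k * \<rho>)\<^sup>2 + 2 * u * (k * \<rho>) + g / b < 0"
    by (simp add: power2_diff algebra_simps)
  then have "b * (- (k * \<rho>)\<^sup>2 + 2 * u * (k * \<rho>) + g / b) < 0"
    using assms(1) by (simp add: mult_pos_neg)
  then show ?thesis using assms(1) by (simp add: u_def algebra_simps)
qed

section \<open>Cauchy hypersurfaces and completeness\<close>

text \<open>An endpoint of the graph would give endpoints of both components, so it is enough that
  one component has none. Towards the past this is always the time component; towards the future it
  may be either one.\<close>

lemma graph_curve_inextensible:
  fixes \<tau> :: "real \<Rightarrow> real" and c :: "real \<Rightarrow> 's::topological_space"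
  assumes "\<And>M. \<exists>s\<^sub>0. \<forall>s\<le>s\<^sub>0. \<bar>\<tau> s\<bar> > M"
    and "(\<nexists>p. upper_endpoint UNIV c p) \<or> (\<forall>M. \<exists>s\<^sub>0. \<forall>s\<ge>s\<^sub>0. \<bar>\<tau> s\<bar> > M)"
  shows "inextensible UNIV (\<lambda>s. (\<tau> s, c s))"
proof -
  have nbhd: "open ({t - 1<..<t + 1} \<times> (UNIV :: 's set))" for t :: real
    by (intro open_Times open_UNIV open_greaterThanLessThan)
  have "\<not> lower_endpoint UNIV (\<lambda>s. (\<tau> s, c s)) (t, p)" for t p
  proof
    assume "lower_endpoint UNIV (\<lambda>s. (\<tau> s, c s)) (t, p)"
    then obtain s0 where s0: "\<And>s. s \<le> s0 \<Longrightarrow> (\<tau> s, c s) \<in> {t - 1<..<t + 1} \<times> UNIV"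
      using nbhd[of t] unfolding lower_endpoint_def by fastforce
    obtain s1 where s1: "\<And>s. s \<le> s1 \<Longrightarrow> \<bar>\<tau> s\<bar> > \<bar>t\<bar> + 1" using assms(1) by blast
    show False using s0[of "min s0 s1"] s1[of "min s0 s1"] by auto
  qed
  moreover have "\<not> upper_endpoint UNIV (\<lambda>s. (\<tau> s, c s)) (t, p)" for t p
  proof
    assume e: "upper_endpoint UNIV (\<lambda>s. (\<tau> s, c s)) (t, p)"
    have "upper_endpoint UNIV c p"
      unfolding upper_endpoint_def
    proof (intro allI impI)
      fix U assume "open U \<and> p \<in> U"
      then have "open ((UNIV :: real set) \<times> U)" "(t, p) \<in> UNIV \<times> U" by (auto intro: open_Times)
      then obtain s0 where "\<And>s. s0 \<le> s \<Longrightarrow> (\<tau> s, c s) \<in> UNIV \<times> U"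
        using e unfolding upper_endpoint_def by blast
      then show "\<exists>s\<^sub>0\<in>UNIV. \<forall>s\<in>UNIV. s\<^sub>0 \<le> s \<longrightarrow> c s \<in> U" by auto
    qed
    then have far: "\<And>M. \<exists>s\<^sub>0. \<forall>s\<ge>s\<^sub>0. \<bar>\<tau> s\<bar> > M" using assms(2) by blast
    obtain s0 where s0: "\<And>s. s \<ge> s0 \<Longrightarrow> (\<tau> s, c s) \<in> {t - 1<..<t + 1} \<times> UNIV"
      using e nbhd[of t] unfolding upper_endpoint_def by fastforce
    obtain s1 where s1: "\<And>s. s \<ge> s1 \<Longrightarrow> \<bar>\<tau> s\<bar> > \<bar>t\<bar> + 1" using far by blast
    show False using s0[of "max s0 s1"] s1[of "max s0 s1"] by auto
  qed
  ultimately show ?thesis unfolding inextensible_def by auto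
qed

theorem corollary5p6:
  fixes A :: "('s::t2_space, 'e::euclidean_space) chart set"
    and g\<^sub>0 :: "('s, 'e) tensor2" and \<omega> :: "('s, 'e) form1" and \<beta> :: "'s \<Rightarrow> real"
    and h :: "('s, 'e) tensor2"
  assumes "smooth_manifold A" and "connected (UNIV :: 's set)"
    and "riemannian_metric A g\<^sub>0" and "smooth_form1 A \<omega>"
    and "smooth_function A \<beta>" and "\<And>x. \<beta> x > 0"
    and "globally_hyperbolic (spacetime_atlas A) (stationary_metric A \<beta> \<omega> g\<^sub>0)"
  defines "h \<equiv> \<lambda>x X Y. 1 / \<beta> x * g\<^sub>0 x X Y + 1 / (\<beta> x)\<^sup>2 * tensor_prod \<omega> \<omega> x X Y"
  shows "riemannian_metric A h \<and> riemannian_complete A h"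
proof
  have atlas: "smooth_atlas A" using assms(1) by (simp add: smooth_manifold_def)
  show metric: "riemannian_metric A h"
    unfolding h_def by (rule riemannian_metric_fermat[OF atlas assms(3-6)])
  interpret G: riemannian_manifold A g\<^sub>0 by unfold_locales (use atlas assms in auto)
  interpret H: riemannian_manifold A h by unfold_locales (rule metric)
  let ?M = "spacetime_atlas A" and ?g = "stationary_metric A \<beta> \<omega> g\<^sub>0"
  obtain \<Sigma> where "cauchy_hypersurface ?M ?g \<Sigma>"
    using assms(7) unfolding globally_hyperbolic_def by blast
  then have \<Sigma>: "\<exists>!s. \<gamma> s \<in> \<Sigma>" if "timelike_curve ?M ?g UNIV \<gamma>" "inextensible UNIV \<gamma>" for \<gamma>
    using that unfolding cauchy_hypersurface_def by (metis UNIV_I)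
  show "riemannian_complete A h"
  proof (rule ccontr)
    assume "\<not> riemannian_complete A h"
    then obtain c T B where c: "smooth_curve_on A UNIV c" "\<nexists>p. upper_endpoint UNIV c p"
      and T: "smooth_on UNIV T" "\<And>s. (T has_real_derivative H.time_rate c s) (at s)"
        "\<And>s. T s \<le> B" "\<And>s. s \<le> 0 \<Longrightarrow> T s \<le> T 0 + s"
      by (rule H.incomplete_imp_time_function[OF assms(2)]) blast
    have rate: "H.time_rate c s > 0" for s
      using H.time_rate_ge[OF c(1), of s] exp_gt_zero[of "- s"] by linarith
    \<comment> \<open>Both signs of \<open>k\<close> occur below. Inextensibility for s towards
      infinity comes from the escape of \<open>c\<close>, since T is bounded above and increasing;
      for s towards minus infinity it comes from the divergence of T.\<close>
    have slope: "\<exists>!s. (k * T s + a, c s) \<in> \<Sigma>" if k: "\<bar>k\<bar> \<ge> 2" for k a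
    proof (rule \<Sigma>)
      have sm: "smooth_on UNIV (\<lambda>s. k * T s + a)"
        by (intro smooth_on_add smooth_on_mult smooth_on_const open_UNIV T(1))
      have der: "((\<lambda>s. k * T s + a) has_real_derivative k * H.time_rate c s) (at s)" for s
        by (auto intro!: derivative_eq_intros T(2))
      show "timelike_curve ?M ?g UNIV (\<lambda>s. (k * T s + a, c s))"
        unfolding timelike_curve_def
      proof (intro conjI ballI)
        show "smooth_curve_on ?M UNIV (\<lambda>s. (k * T s + a, c s))"
          by (rule G.graph_curve_smooth[OF sm c(1)])
        fix s :: real
        let ?v = "velocity A c s"
        have "1 / \<beta> (c s) * g\<^sub>0 (c s) ?v ?v + 1 / (\<beta> (c s))\<^sup>2 * (\<omega> (c s) ?v * \<omega> (c s) ?v) < (H.time_rate c s)\<^sup>2"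
        proof -
          \<comment> \<open>Strict because of the exponential summand, even where \<open>c\<close>
            stands still.\<close>
          have "h (c s) ?v ?v < (H.time_rate c s)\<^sup>2"
            using H.metric_nonneg[OF G.velocity_tangent[OF open_UNIV c(1) UNIV_I], of s]
            by (simp add: H.time_rate_def)
          moreover have "h (c s) ?v ?v
              = 1 / \<beta> (c s) * g\<^sub>0 (c s) ?v ?v + 1 / (\<beta> (c s))\<^sup>2 * (\<omega> (c s) ?v * \<omega> (c s) ?v)"
            by (simp add: h_def tensor_prod_def)
          ultimately show ?thesis by simp
        qed
        then show "?g (k * T s + a, c s) (velocity ?M (\<lambda>s. (k * T s + a, c s)) s)
            (velocity ?M (\<lambda>s. (k * T s + a, c s)) s) < 0"
          unfolding G.stationary_metric_graph_curve[OF c(1) der]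
          by (intro timelike_estimate assms(6) k rate
              G.metric_nonneg[OF G.velocity_tangent[OF open_UNIV c(1) UNIV_I]])
      qed auto
      show "inextensible UNIV (\<lambda>s. (k * T s + a, c s))"
      proof (rule graph_curve_inextensible)
        fix M
        have "\<bar>k * T s + a\<bar> > M" if "s \<le> min 0 (- \<bar>T 0\<bar> - \<bar>M\<bar> - \<bar>a\<bar> - 1)" for s
        proof -
          have "T s \<le> - \<bar>M\<bar> - \<bar>a\<bar> - 1" using T(4)[of s] that by linarith
          then have "\<bar>T s\<bar> \<ge> \<bar>M\<bar> + \<bar>a\<bar> + 1" by linarith
          moreover have "\<bar>k * T s\<bar> \<ge> 2 * \<bar>T s\<bar>"
            using mult_right_mono[OF k, of "\<bar>T s\<bar>"] by (simp add: abs_mult)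
          ultimately show ?thesis by linarith
        qed
        then show "\<exists>s\<^sub>0. \<forall>s\<le>s\<^sub>0. \<bar>k * T s + a\<bar> > M" by blast
      qed (use c(2) in blast)
    qed
    \<comment> \<open>Only uniqueness is used later: two points of \<open>\<Sigma>\<close> at
      different times must lie over different parameters of \<open>c\<close>.\<close>
    have vertical: "\<exists>!s. (s, p) \<in> \<Sigma>" for p
    proof (rule \<Sigma>)
      have const: "smooth_curve_on A UNIV (\<lambda>_. p)" by (rule G.smooth_curve_on_const)
      show "timelike_curve ?M ?g UNIV (\<lambda>s. (s, p))"
        unfolding timelike_curve_def
      proof (intro conjI ballI)
        show "smooth_curve_on ?M UNIV (\<lambda>s. (s, p))"
          by (rule G.graph_curve_smooth[OF smooth_on_ident[OF open_UNIV] const])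
        fix s :: real
        have "\<omega> p (\<lambda>_. 0) = 0"
        proof -
          obtain d where d: "d \<in> A" "p \<in> chart_dom d" by (rule G.chart_around)
          have "linear_form_at A p (\<omega> p)" using assms(4) by (simp add: smooth_form1_def)
          from this[unfolded linear_form_at_def, rule_format,
              OF G.tvec_of_tangent[OF d] G.tvec_of_tangent[OF d], of 0 0 0 0]
          show ?thesis by simp
        qed
        then show "?g (s, p) (velocity ?M (\<lambda>s. (s, p)) s) (velocity ?M (\<lambda>s. (s, p)) s) < 0"
          unfolding G.stationary_metric_graph_curve[OF const DERIV_ident]
          by (simp add: G.velocity_const G.metric_zero assms(6))
      qed auto
      have "\<forall>s\<le>- \<bar>M\<bar> - 1. \<bar>s\<bar> > M" "\<forall>s\<ge>\<bar>M\<bar> + 1. \<bar>s\<bar> > M" for M :: real by auto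
      then show "inextensible UNIV (\<lambda>s. (s, p))"
        by (intro graph_curve_inextensible) blast+
    qed
    text \<open>Two points of \<open>\<Sigma>\<close> over \<open>c\<close> are joined by a curve of constant slope with respect to \<open>T\<close>, so that
      the slope must be less than 2 in absolute value. As \<open>T\<close> is bounded above, this forbids the curve of
      slope 2 to meet \<open>\<Sigma>\<close> once it has been shifted far enough into the past.\<close>
    obtain s0 where s0: "(2 * T s0 + 0, c s0) \<in> \<Sigma>" using slope[of 2 0] by auto
    \<comment> \<open>When \<open>T s1\<close> exceeds \<open>T s0\<close>, the difference is at
      most \<open>B - T s0\<close>. The factor 4 then lowers the connecting slope from 2 to at most
      -2, and the summand 1 makes the shift positive even if \<open>T s0\<close> equals
      \<open>B\<close>.\<close>
    define N where "N = 4 * (B - T s0) + 1"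
    have N: "N > 0" using T(3)[of s0] by (simp add: N_def)
    obtain s1 where s1: "(2 * T s1 + - N, c s1) \<in> \<Sigma>" using slope[of 2 "- N"] by auto
    have "s1 \<noteq> s0"
    proof
      assume "s1 = s0"
      then have "2 * T s0 + 0 = 2 * T s0 + - N" using vertical[of "c s0"] s0 s1 by blast
      then show False using N by simp
    qed
    moreover have "T x < T y" if "x < y" for x y
      using DERIV_pos_imp_increasing[OF that, of T] T(2) rate by blast
    ultimately have ne: "T s1 \<noteq> T s0" by (metis less_irrefl linorder_neqE)
    \<comment> \<open>The slope, measured against T, of the line through the two points of
      \<open>\<Sigma>\<close>: their times differ by \<open>2 * (T s1 - T s0) - N\<close>.\<close>
    define k where "k = 2 - N / (T s1 - T s0)"
    have "\<bar>k\<bar> \<ge> 2"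
    proof (cases "T s1 < T s0")
      case True
      then have "N / (T s1 - T s0) \<le> 0" using N by (simp add: divide_nonneg_neg)
      then show ?thesis by (simp add: k_def)
    next
      case False
      then have "4 * (T s1 - T s0) \<le> N" "T s1 - T s0 > 0" using ne T(3)[of s1] by (auto simp: N_def)
      then have "N / (T s1 - T s0) \<ge> 4" by (simp add: pos_le_divide_eq)
      then show ?thesis by (simp add: k_def)
    qed
    \<comment> \<open>The shift makes the curve of slope \<open>k\<close> pass through the first
      point at \<open>s0\<close>; by the choice of \<open>k\<close> it also passes through the
      second one at \<open>s1\<close>.\<close>
    from slope[OF this, of "2 * T s0 - k * T s0"]
    have "\<exists>!s. (k * T s + (2 * T s0 - k * T s0), c s) \<in> \<Sigma>" .
    moreover have "k * T s1 + (2 * T s0 - k * T s0) = 2 * T s1 + - N"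
    proof -
      have "k * (T s1 - T s0) = 2 * (T s1 - T s0) - N" using ne by (simp add: k_def field_simps)
      then show ?thesis by (simp add: algebra_simps)
    qed
    then have "(k * T s1 + (2 * T s0 - k * T s0), c s1) \<in> \<Sigma>" using s1 by simp
    moreover have "(k * T s0 + (2 * T s0 - k * T s0), c s0) \<in> \<Sigma>" using s0 by simp
    ultimately show False using \<open>s1 \<noteq> s0\<close> by blast
  qed
qed

end
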